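(* Let $k\geq 1$ and $s\geq 1$ be integers and let $\alpha\in[\frac{ks}{ks+s-1},1]$ be rational. Let $\ell$ be the smallest positive integer such that $\frac{\ell}{2ks}$ and $\frac{\alpha\ell}{2ks}$ are integers. There exist integers $t_0,q_0$ such that for every integer $t\geq t_0$ and every prime power $q\geq q_0$ there exists a bipartite graph $G$ with parts $M,N$, $|M|=q^{\alpha\ell}$, $|N|=q^{\ell}$, such that $G$ is $K_{s,t}^{(2k)}$-free and \[e(G)\geq \frac12 |M|^{\frac12+\frac{1}{2k}-\frac{1}{2ks}}|N|^{\frac12}.\]
   Context: For a graph $H$ and a positive integer $k$, $H^{(k)}$ is obtained from $H$ by replacing each edge $uv$ by a path of length $k$ from $u$ to $v$, these paths being pairwise internally vertex-disjoint. $K_{s,t}$ is the complete bipartite graph with parts of sizes $s$ and $t$. *)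

theory Defs
  imports Complex_Main "HOL-Number_Theory.Prime_Powers"
begin

type_synonym 'a ugraph = "'a set \<times> 'a set set"

abbreviation verts :: "'a ugraph \<Rightarrow> 'a set" where
  "verts G \<equiv> fst G"

abbreviation edges :: "'a ugraph \<Rightarrow> 'a set set" where
  "edges G \<equiv> snd G"

definition finite_simple_graph :: "'a ugraph \<Rightarrow> bool" where
  "finite_simple_graph G \<longleftrightarrow>
     finite (verts G) \<and> (\<forall>e\<in>edges G. e \<subseteq> verts G \<and> card e = 2)"

definition bipartite_with_parts :: "'a ugraph \<Rightarrow> 'a set \<Rightarrow> 'a set \<Rightarrow> bool" where
  "bipartite_with_parts G M N \<longleftrightarrow>
     finite_simple_graph G \<and> verts G = M \<union> N \<and> M \<inter> N = {} \<and>
     (\<forall>e\<in>edges G. \<exists>x\<in>M. \<exists>y\<in>N. e = {x, y})"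

text \<open>Subgraph copies are not required to be induced.\<close>

definition contains_copy :: "'a ugraph \<Rightarrow> 'b ugraph \<Rightarrow> bool" where
  "contains_copy G H \<longleftrightarrow>
     (\<exists>f. inj_on f (verts H) \<and> f ` verts H \<subseteq> verts G \<and> (\<forall>e\<in>edges H. f ` e \<in> edges G))"

definition is_free :: "'b ugraph \<Rightarrow> 'a ugraph \<Rightarrow> bool" where
  "is_free H G \<longleftrightarrow> \<not> contains_copy G H"

definition complete_bipartite :: "nat \<Rightarrow> nat \<Rightarrow> nat ugraph" where
  "complete_bipartite s t = ({..<s + t}, {{i, j} | i j. i < s \<and> s \<le> j \<and> j < s + t})"

text \<open>
  The path of length \<open>k\<close> replacing the edge \<open>e\<close> runs from \<open>Min e\<close> to \<open>Max e\<close>; its vertex at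
  distance \<open>i\<close> from \<open>Min e\<close> is \<open>subdiv_path k e i\<close>, and its internal vertices are \<open>Inr (e, i)\<close>
  with \<open>0 < i < k\<close>. The linear order only serves to choose a direction for each path; up to
  isomorphism the result does not depend on it. Only \<open>k \<ge> 1\<close> is meaningful.
\<close>

definition subdiv_path :: "nat \<Rightarrow> 'a::linorder set \<Rightarrow> nat \<Rightarrow> 'a + 'a set \<times> nat" where
  "subdiv_path k e i =
     (if i = 0 then Inl (Min e) else if i = k then Inl (Max e) else Inr (e, i))"

definition subdivision :: "nat \<Rightarrow> 'a::linorder ugraph \<Rightarrow> ('a + 'a set \<times> nat) ugraph" where
  "subdivision k H =
     (Inl ` verts H \<union> Inr ` (edges H \<times> {0<..<k}),
      {{subdiv_path k e i, subdiv_path k e (Suc i)} | e i. e \<in> edges H \<and> i < k})"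

end

theory Submission
  imports Defs "HOL-Computational_Algebra.Polynomial"
begin

text \<open>
  The graph is bipartite between \<open>F\<^sup>a\<close> and \<open>F\<^sup>l\<close>, where \<open>F\<close> is the field with \<open>q\<close> elements and
  \<open>a = \<alpha> l\<close>. A vertex \<open>x\<close> is joined to \<open>y\<close> if the first \<open>c\<close> coordinates of \<open>x\<close> are prescribed polynomials
  \<open>G\<^sub>1, \<dots>, G\<^sub>c\<close> in the remaining coordinates of \<open>x\<close> and in \<open>y\<close>; the choice of \<open>c\<close> makes the number of
  edges exactly the required power of \<open>q\<close>, and the lower bound on \<open>\<alpha>\<close> says \<open>c \<le> a\<close>.

  A copy of the forbidden graph is a family of spiders with common leaves and otherwise disjoint. The
  parameter \<open>c\<close> is such that one more spider has at most as many coordinates as it imposes linear equations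
  on the coefficients of the \<open>G\<^sub>i\<close>. Hence, for \<open>n\<close> spiders with \<open>n\<close> larger than the number of coordinates
  of the leaves, all the coefficients together with one coordinate \<open>\<theta>\<^sub>j\<close> of each centre are polynomials of
  bounded degree in fewer parameters: interpolation recovers a block of coefficients from the rest. So
  they satisfy a fixed nonzero polynomial relation \<open>Q (coefficients, \<theta>\<^sub>1, \<dots>, \<theta>\<^sub>n) = 0\<close> whose degree does
  not depend on \<open>q\<close>. Fix coefficients for which no such \<open>Q\<close> vanishes identically in \<open>\<theta>\<close>. If there were
  very many spiders, some coordinate of the centres would take many values, and \<open>Q\<close> multiplied by
  \<open>\<Prod>\<^sub>i\<^sub><\<^sub>j (\<theta>\<^sub>i - \<theta>\<^sub>j)\<close> would vanish on a large grid, hence identically.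
\<close>

section \<open>Polynomial functions over a residue field\<close>

text \<open>
  A type cannot depend on \<open>q\<close>, so the field with \<open>q\<close> elements is given by a prime ideal \<open>Z\<close> of a fixed
  commutative ring and a set \<open>F\<close> of representatives of its cosets; \<open>x \<in> Z\<close> reads \<open>x = 0\<close>.
\<close>

locale residue_field =
  fixes Z :: "'a::comm_ring_1 set" and F :: "'a set"
  assumes zero: "0 \<in> Z"
    and diff: "x \<in> Z \<Longrightarrow> y \<in> Z \<Longrightarrow> x - y \<in> Z"
    and mult: "x \<in> Z \<Longrightarrow> y * x \<in> Z"
    and prime: "x * y \<in> Z \<Longrightarrow> x \<in> Z \<or> y \<in> Z"
    and one: "1 \<notin> Z"
    and finite_reps: "finite F"
    and reps: "\<exists>f\<in>F. x - f \<in> Z"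
    and reps_unique: "f \<in> F \<Longrightarrow> g \<in> F \<Longrightarrow> f - g \<in> Z \<Longrightarrow> f = g"
begin

lemma uminus: "x \<in> Z \<Longrightarrow> - x \<in> Z"
  using diff[OF zero, of x] by simp

lemma add: "x \<in> Z \<Longrightarrow> y \<in> Z \<Longrightarrow> x + y \<in> Z"
  using diff[of x "- y"] uminus[of y] by simp

lemma mult': "x \<in> Z \<Longrightarrow> x * y \<in> Z"
  using mult[of x y] by (simp add: mult.commute)

lemma diff_commute: "x - y \<in> Z \<longleftrightarrow> y - x \<in> Z"
  using uminus[of "x - y"] uminus[of "y - x"] by auto

lemma diff_trans: "x - y \<in> Z \<Longrightarrow> y - z \<in> Z \<Longrightarrow> x - z \<in> Z"
  using add[of "x - y" "y - z"] by simp

lemma mem_cong: "x - y \<in> Z \<Longrightarrow> x \<in> Z \<longleftrightarrow> y \<in> Z"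
  using add[of "x - y" y] diff[of x "x - y"] by auto

lemma sum_mem: "(\<And>i. i \<in> A \<Longrightarrow> f i \<in> Z) \<Longrightarrow> sum f A \<in> Z"
  by (induction A rule: infinite_finite_induct) (auto simp: zero add)

lemma mult_cong: "x - x' \<in> Z \<Longrightarrow> y - y' \<in> Z \<Longrightarrow> x * y - x' * y' \<in> Z"
  using add[OF mult[of "y - y'" x] mult'[of "x - x'" y']] by (simp add: algebra_simps)

lemma sum_cong: "(\<And>i. i \<in> A \<Longrightarrow> f i - g i \<in> Z) \<Longrightarrow> sum f A - sum g A \<in> Z"
  using sum_mem[of A "\<lambda>i. f i - g i"] by (simp add: sum_subtractf)

lemma prod_cong: "(\<And>i. i \<in> A \<Longrightarrow> f i - g i \<in> Z) \<Longrightarrow> prod f A - prod g A \<in> Z"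
  by (induction A rule: infinite_finite_induct) (auto simp: zero intro!: mult_cong)

lemma power_cong: "x - y \<in> Z \<Longrightarrow> x ^ n - y ^ n \<in> Z"
  by (induction n) (auto simp: zero intro!: mult_cong)

lemma prod_mem_iff: "finite A \<Longrightarrow> prod f A \<in> Z \<longleftrightarrow> (\<exists>i\<in>A. f i \<in> Z)"
  by (induction A rule: finite_induct) (use one prime mult mult' in auto)

definition rep :: "'a \<Rightarrow> 'a" where "rep x = (SOME f. f \<in> F \<and> x - f \<in> Z)"

lemma rep: "rep x \<in> F" "x - rep x \<in> Z" "rep x - x \<in> Z"
proof -
  have "rep x \<in> F \<and> x - rep x \<in> Z"
    unfolding rep_def by (rule someI_ex) (use reps in blast)
  then show "rep x \<in> F" "x - rep x \<in> Z" "rep x - x \<in> Z"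
    using diff_commute by blast+
qed

lemma rep_eq_iff: "rep x = rep y \<longleftrightarrow> x - y \<in> Z"
proof
  assume "rep x = rep y"
  then show "x - y \<in> Z" using rep(2)[of x] rep(3)[of y] diff_trans by metis
next
  assume "x - y \<in> Z"
  then have "rep x - rep y \<in> Z" using rep(3)[of x] rep(2)[of y] diff_trans by metis
  then show "rep x = rep y" using reps_unique rep(1) by blast
qed

text \<open>Multiplication by \<open>x\<close> is injective on the finite set \<open>F\<close> of
  representatives, hence onto, and so reaches the representative of 1.\<close>

lemma inverse_exists:
  assumes "x \<notin> Z"
  obtains y where "x * y - 1 \<in> Z"
proof -
  have "inj_on (\<lambda>f. rep (x * f)) F"
  proof (rule inj_onI)
    fix f g assume fg: "f \<in> F" "g \<in> F" "rep (x * f) = rep (x * g)"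
    then have "x * (f - g) \<in> Z" by (simp add: rep_eq_iff algebra_simps)
    then show "f = g" using prime assms reps_unique fg by blast
  qed
  then have "(\<lambda>f. rep (x * f)) ` F = F"
    by (intro endo_inj_surj finite_reps) (use rep in auto)
  then obtain f where "rep (x * f) = rep 1" using rep(1) by (metis imageE)
  then show thesis using that by (simp add: rep_eq_iff)
qed

text \<open>Fermat's little theorem: multiplication by a nonzero \<open>x\<close> permutes the
  nonzero representatives, and the two resulting expressions for their product are compared.\<close>

lemma power_card_minus_self: "x ^ card F - x \<in> Z"
proof (cases "x \<in> Z")
  case True
  have "card F > 0" using finite_reps rep(1) card_gt_0_iff by blast
  then have "x ^ card F \<in> Z" using True mult' by (cases "card F") auto
  then show ?thesis using True diff by blast
next
  case False
  define N where "N = F - {rep 0}"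
  have N: "f \<in> N \<longleftrightarrow> f \<in> F \<and> f \<notin> Z" for f
    using rep(1,3)[of 0] reps_unique[of f "rep 0"] mem_cong[of f "rep 0"] zero mem_cong[of "rep 0" 0]
    unfolding N_def by (auto intro: diff)
  have fin: "finite N" and card: "card F = Suc (card N)"
    unfolding N_def using finite_reps rep(1) card_Suc_Diff1 by (metis finite_Diff, metis)
  have "inj_on (\<lambda>f. rep (x * f)) N"
  proof (rule inj_onI)
    fix f g assume fg: "f \<in> N" "g \<in> N" "rep (x * f) = rep (x * g)"
    then have "x * (f - g) \<in> Z" by (simp add: rep_eq_iff algebra_simps)
    then show "f = g" using prime False reps_unique fg N by blast
  qed
  moreover have "rep (x * f) \<in> N" if "f \<in> N" for f
    using that False prime[of x f] rep[of "x * f"] mem_cong[of "x * f" "rep (x * f)"] N by blast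
  ultimately have bij: "bij_betw (\<lambda>f. rep (x * f)) N N"
    using endo_inj_surj[OF fin, of "\<lambda>f. rep (x * f)"] by (simp add: bij_betw_def image_subset_iff)
  have "(\<Prod>f\<in>N. x * f) - (\<Prod>f\<in>N. rep (x * f)) \<in> Z"
    by (intro prod_cong rep)
  also have "(\<Prod>f\<in>N. rep (x * f)) = \<Prod>N"
    using prod.reindex_bij_betw[OF bij, of "\<lambda>f. f"] by simp
  finally have "\<Prod>N * (x ^ card N - 1) \<in> Z"
    by (simp add: prod.distrib algebra_simps)
  moreover have "\<Prod>N \<notin> Z" using prod_mem_iff[OF fin, of "\<lambda>f. f"] N by auto
  ultimately have "x ^ card N - 1 \<in> Z" using prime by blast
  then show ?thesis using mult[of "x ^ card N - 1" x] card by (simp add: algebra_simps)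
qed

text \<open>Roots are split off one by one by synthetic division; primality of \<open>Z\<close>
  passes the remaining roots on to the quotient. The conclusion concerns coefficients and not only
  values, so one nonzero coefficient shows that a polynomial is nonzero as a function.\<close>

lemma coeffs_mem_of_roots:
  assumes "degree P \<le> d" "finite X" "card X > d"
    and "\<And>x. x \<in> X \<Longrightarrow> poly P x \<in> Z"
    and "\<And>x y. x \<in> X \<Longrightarrow> y \<in> X \<Longrightarrow> x - y \<in> Z \<Longrightarrow> x = y"
  shows "coeff P i \<in> Z"
  using assms
proof (induction d arbitrary: P X i)
  case 0
  then obtain a where P: "P = [:a:]" using degree_eq_zeroE by blast
  obtain x where "x \<in> X" using 0 by fastforce
  then show ?case using 0(4)[of x] P by (auto simp: coeff_pCons zero split: nat.splits)
next
  case (Suc d)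
  obtain x where x: "x \<in> X" using Suc.prems by fastforce
  define Q where "Q = synthetic_div P x"
  have P: "P = [:- x, 1:] * Q + [:poly P x:]"
    unfolding Q_def by (rule synthetic_div_correct'[symmetric])
  have "coeff Q i \<in> Z" for i
  proof (rule Suc.IH[of Q "X - {x}"])
    show "degree Q \<le> d" unfolding Q_def using Suc.prems by (simp add: degree_synthetic_div)
    show "finite (X - {x})" "d < card (X - {x})" using Suc.prems x by auto
    show "poly Q y \<in> Z" if "y \<in> X - {x}" for y
    proof -
      have "poly P y = (y - x) * poly Q y + poly P x"
        by (subst P) (simp add: algebra_simps)
      then have "(y - x) * poly Q y \<in> Z"
        using diff[OF Suc.prems(4)[of y] Suc.prems(4)[of x]] x that by simp
      then show ?thesis using prime Suc.prems(5) x that by blast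
    qed
  qed (use Suc.prems in auto)
  moreover have "coeff P i = (case i of 0 \<Rightarrow> poly P x | Suc j \<Rightarrow> coeff Q j) - x * coeff Q i"
    by (subst P) (auto simp: coeff_pCons split: nat.splits)
  ultimately show ?case using Suc.prems(4)[OF x] mult
    by (auto split: nat.splits intro!: diff)
qed

lemma poly_mem_of_roots:
  assumes "degree P \<le> d" "finite X" "card X > d"
    and "\<And>x. x \<in> X \<Longrightarrow> poly P x \<in> Z"
    and "\<And>x y. x \<in> X \<Longrightarrow> y \<in> X \<Longrightarrow> x - y \<in> Z \<Longrightarrow> x = y"
  shows "poly P x \<in> Z"
  unfolding poly_altdef by (intro sum_mem mult' coeffs_mem_of_roots[OF assms])

end

section \<open>Polynomial functions of bounded total degree in any number of variables\<close>

text \<open>Functions stand in for polynomials, since only values on lines and grids matter. The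
  index \<open>d\<close> is an upper bound for the total degree, and the slack \<open>n\<close> in
  \<open>mult\<close> gives monotonicity in \<open>d\<close>.\<close>

inductive polyfun :: "nat \<Rightarrow> (('v \<Rightarrow> 'a::comm_ring_1) \<Rightarrow> 'a) \<Rightarrow> bool" where
  const: "polyfun d (\<lambda>u. a)"
| var: "d \<ge> 1 \<Longrightarrow> polyfun d (\<lambda>u. u i)"
| add: "polyfun d f \<Longrightarrow> polyfun d g \<Longrightarrow> polyfun d (\<lambda>u. f u + g u)"
| mult: "polyfun d f \<Longrightarrow> polyfun e g \<Longrightarrow> d + e \<le> n \<Longrightarrow> polyfun n (\<lambda>u. f u * g u)"

lemma polyfun_mono: "polyfun d f \<Longrightarrow> d \<le> e \<Longrightarrow> polyfun e f"
proof (induction arbitrary: e rule: polyfun.induct)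
  case (mult d f d' g n)
  show ?case by (rule polyfun.mult[OF mult(1,2)]) (use mult in simp)
qed (auto intro: polyfun.const polyfun.var polyfun.add)

lemma polyfun_mult: "polyfun d f \<Longrightarrow> polyfun e g \<Longrightarrow> polyfun (d + e) (\<lambda>u. f u * g u)"
  by (rule polyfun.mult) auto

lemma polyfun_uminus: "polyfun d f \<Longrightarrow> polyfun d (\<lambda>u. - f u)"
  using polyfun.mult[OF polyfun.const[of 0 "-1"], of d f d] by simp

lemma polyfun_diff: "polyfun d f \<Longrightarrow> polyfun d g \<Longrightarrow> polyfun d (\<lambda>u. f u - g u)"
  using polyfun.add[OF _ polyfun_uminus, of d f g] by simp

lemma polyfun_sum: "(\<And>i. i \<in> A \<Longrightarrow> polyfun d (f i)) \<Longrightarrow> polyfun d (\<lambda>u. \<Sum>i\<in>A. f i u)"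
  by (induction A rule: infinite_finite_induct) (auto intro: polyfun.const polyfun.var polyfun.add)

lemma polyfun_prod: "(\<And>i. i \<in> A \<Longrightarrow> polyfun d (f i)) \<Longrightarrow> polyfun (card A * d) (\<lambda>u. \<Prod>i\<in>A. f i u)"
  by (induction A rule: infinite_finite_induct) (auto intro: polyfun.const polyfun_mult)

lemma polyfun_prod': "(\<And>i. i \<in> A \<Longrightarrow> polyfun (d i) (f i)) \<Longrightarrow> polyfun (\<Sum>i\<in>A. d i) (\<lambda>u. \<Prod>i\<in>A. f i u)"
  by (induction A rule: infinite_finite_induct) (auto intro: polyfun.const polyfun_mult)

lemma polyfun_power: "polyfun d f \<Longrightarrow> polyfun (n * d) (\<lambda>u. f u ^ n)"
  using polyfun_prod[of "{..<n}" d "\<lambda>_. f"] by simp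

lemma polyfun_compose: "polyfun d f \<Longrightarrow> (\<And>i. polyfun h (g i)) \<Longrightarrow> polyfun (d * h) (\<lambda>u. f (\<lambda>i. g i u))"
proof (induction rule: polyfun.induct)
  case (var d i) then show ?case using polyfun_mono[of h "g i" "d * h"] by simp
next
  case (mult d f e g n)
  then have "d * h + e * h \<le> n * h" by (metis add_mult_distrib mult_le_mono1)
  then show ?case using polyfun.mult[OF mult.IH] mult.prems by simp
qed (auto intro: polyfun.const polyfun.var polyfun.add)

text \<open>The bridge to root counting for univariate polynomials; it is applied to the line
  joining two points and to the variation of a single coordinate.\<close>

lemma polyfun_line:
  assumes "polyfun d f"
  shows "\<exists>P. degree P \<le> d \<and> (\<forall>t. poly P t = f (\<lambda>i. a i + t * b i))"
  using assms
proof (induction rule: polyfun.induct)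
  case (const d c) then show ?case by (intro exI[of _ "[:c:]"]) auto
next
  case (var d i) then show ?case by (intro exI[of _ "[:a i, b i:]"]) auto
next
  case (add d f g)
  then obtain P Q where "degree P \<le> d" "\<forall>t. poly P t = f (\<lambda>i. a i + t * b i)"
    "degree Q \<le> d" "\<forall>t. poly Q t = g (\<lambda>i. a i + t * b i)" by blast
  then show ?case by (intro exI[of _ "P + Q"]) (auto intro: degree_add_le)
next
  case (mult d f e g n)
  then obtain P Q where "degree P \<le> d" "\<forall>t. poly P t = f (\<lambda>i. a i + t * b i)"
    "degree Q \<le> e" "\<forall>t. poly Q t = g (\<lambda>i. a i + t * b i)" by blast
  then show ?case using mult(3) degree_mult_le[of P Q]
    by (intro exI[of _ "P * Q"]) auto
qed

context residue_field
begin

text \<open>On the line joining \<open>u\<close> and \<open>v\<close>, both functions restrict to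
  nonzero polynomials, which together have at most \<open>d + e\<close> roots in \<open>F\<close>;
  some parameter in \<open>F\<close> avoids them all.\<close>

lemma polyfun_mult_nonzero:
  assumes f: "polyfun d f" "f u \<notin> Z" and g: "polyfun e g" "g v \<notin> Z" and "d + e < card F"
  shows "\<exists>w. f w * g w \<notin> Z"
proof -
  obtain P where P: "degree P \<le> d" "\<And>t. poly P t = f (\<lambda>i. u i + t * (v i - u i))"
    using polyfun_line[OF f(1)] by metis
  obtain Q where Q: "degree Q \<le> e" "\<And>t. poly Q t = g (\<lambda>i. u i + t * (v i - u i))"
    using polyfun_line[OF g(1)] by metis
  define A where "A = {t\<in>F. poly P t \<in> Z}"
  define B where "B = {t\<in>F. poly Q t \<in> Z}"
  have "poly P 0 \<notin> Z" "poly Q 1 \<notin> Z" using f g P Q by simp_all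
  moreover have "poly P 0 \<in> Z" if "card A > d"
    by (rule poly_mem_of_roots[OF P(1) _ that]) (use finite_reps reps_unique in \<open>auto simp: A_def\<close>)
  moreover have "poly Q 1 \<in> Z" if "card B > e"
    by (rule poly_mem_of_roots[OF Q(1) _ that]) (use finite_reps reps_unique in \<open>auto simp: B_def\<close>)
  ultimately have "\<not> card A > d" "\<not> card B > e" by blast+
  then have "card (A \<union> B) < card F" using card_Un_le[of A B] assms by linarith
  then have "\<not> F \<subseteq> A \<union> B"
    using card_mono[of "A \<union> B" F] finite_reps unfolding A_def B_def by auto
  then obtain t where "t \<in> F" "poly P t \<notin> Z" "poly Q t \<notin> Z" unfolding A_def B_def by blast
  then show ?thesis using P Q prime by metis
qed

lemma polyfun_prod_nonzero:
  assumes "finite A" "\<And>i. i \<in> A \<Longrightarrow> polyfun (d i) (f i)" "\<And>i. i \<in> A \<Longrightarrow> \<exists>u. f i u \<notin> Z"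
    and "(\<Sum>i\<in>A. d i) < card F"
  shows "\<exists>u. \<forall>i\<in>A. f i u \<notin> Z"
proof -
  have "\<exists>u. (\<Prod>i\<in>A. f i u) \<notin> Z"
    using assms
  proof (induction A rule: finite_induct)
    case empty then show ?case using one by simp
  next
    case (insert i A)
    then obtain u where u: "(\<Prod>i\<in>A. f i u) \<notin> Z" by fastforce
    obtain v where v: "f i v \<notin> Z" using insert by blast
    have "polyfun (\<Sum>i\<in>A. d i) (\<lambda>u. \<Prod>i\<in>A. f i u)" using insert by (intro polyfun_prod') auto
    then show ?case
      using polyfun_mult_nonzero[of "d i" "f i" v "\<Sum>i\<in>A. d i" "\<lambda>u. \<Prod>i\<in>A. f i u" u] u v insert by simp
  qed
  then show ?thesis using prod_mem_iff[OF assms(1)] by blast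
qed

text \<open>The coordinates in \<open>A\<close> are released one at a time: in a single coordinate
  the function is a polynomial of degree at most \<open>d\<close> that vanishes on \<open>X\<close>.
  Varying \<open>w\<close> lets the induction freeze that coordinate at a point of
  \<open>X\<close>.\<close>

lemma polyfun_zero_of_grid:
  assumes "polyfun d f" "finite A" "finite X" "card X > d"
    and X: "\<And>x y. x \<in> X \<Longrightarrow> y \<in> X \<Longrightarrow> x - y \<in> Z \<Longrightarrow> x = y"
    and "\<And>u. (\<And>i. i \<in> A \<Longrightarrow> u i \<in> X) \<Longrightarrow> (\<And>i. i \<notin> A \<Longrightarrow> u i = w i) \<Longrightarrow> f u \<in> Z"
    and "\<And>i. i \<notin> A \<Longrightarrow> u i = w i"
  shows "f u \<in> Z"
  using assms(2,6,7)
proof (induction A arbitrary: u w rule: finite_induct)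
  case empty then show ?case by auto
next
  case (insert i A)
  have line: "f (u(i := x)) \<in> Z" if "x \<in> X" for x
  proof (rule insert.IH[of "w(i := x)"])
    fix u' assume "\<And>j. j \<in> A \<Longrightarrow> u' j \<in> X" "\<And>j. j \<notin> A \<Longrightarrow> u' j = (w(i := x)) j"
    then show "f u' \<in> Z" using insert.hyps that by (intro insert.prems) auto
  qed (use insert in auto)
  obtain P where P: "degree P \<le> d" "\<And>t. poly P t = f (\<lambda>j. (u(i := 0)) j + t * (if j = i then 1 else 0))"
    using polyfun_line[OF assms(1)] by metis
  have eq: "(\<lambda>j. (u(i := 0)) j + t * (if j = i then 1 else 0)) = u(i := t)" for t by auto
  have "poly P (u i) \<in> Z"
    by (rule poly_mem_of_roots[OF P(1) assms(3,4)]) (use line X in \<open>simp_all only: P eq\<close>)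
  then show ?case by (simp only: P eq fun_upd_triv)
qed

end

section \<open>Finite fields\<close>

text \<open>All inner binomial coefficients of exponent \<open>p\<close> are divisible by
  \<open>p\<close>.\<close>

lemma prime_dvd_power_add_diff:
  fixes f g :: "'a::comm_ring_1"
  assumes "prime p"
  shows "of_nat p dvd (f + g) ^ p - (f ^ p + g ^ p)"
proof -
  have p: "p > 0" using assms prime_gt_0_nat by blast
  have "{..p} = insert 0 (insert p {0<..<p})" using p by auto
  then have "(f + g) ^ p - (f ^ p + g ^ p) = (\<Sum>k\<in>{0<..<p}. of_nat (p choose k) * f ^ k * g ^ (p - k))"
    using p by (simp add: binomial_ring)
  moreover have "of_nat p dvd (of_nat (p choose k) :: 'a)" if "k \<in> {0<..<p}" for k
    using dvd_choose_prime[of k p] assms that by (auto elim!: dvdE)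
  ultimately show ?thesis by (auto intro!: dvd_sum)
qed

definition is_ideal :: "'a::comm_ring_1 set \<Rightarrow> bool" where
  "is_ideal J \<longleftrightarrow> 0 \<in> J \<and> (\<forall>x\<in>J. \<forall>y\<in>J. x - y \<in> J) \<and> (\<forall>x\<in>J. \<forall>y. y * x \<in> J)"

lemma is_idealD:
  assumes "is_ideal J"
  shows "0 \<in> J" "x \<in> J \<Longrightarrow> y \<in> J \<Longrightarrow> x - y \<in> J" "x \<in> J \<Longrightarrow> y * x \<in> J" "x \<in> J \<Longrightarrow> x * y \<in> J"
    "x \<in> J \<Longrightarrow> y \<in> J \<Longrightarrow> x + y \<in> J"
proof -
  have *: "0 \<in> J" "\<And>x y. x \<in> J \<Longrightarrow> y \<in> J \<Longrightarrow> x - y \<in> J" "\<And>x y. x \<in> J \<Longrightarrow> y * x \<in> J"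
    using assms unfolding is_ideal_def by blast+
  show "0 \<in> J" "x \<in> J \<Longrightarrow> y \<in> J \<Longrightarrow> x - y \<in> J" "x \<in> J \<Longrightarrow> y * x \<in> J" "x \<in> J \<Longrightarrow> x * y \<in> J"
    using * by (auto simp: mult.commute)
  show "x \<in> J \<Longrightarrow> y \<in> J \<Longrightarrow> x + y \<in> J" using *(2)[of x "0 - y"] *(2)[OF *(1), of y] by simp
qed

lemma ideal_power_add:
  fixes J :: "'a::comm_ring_1 set"
  assumes J: "is_ideal J" "of_nat p \<in> J" and p: "prime p"
  shows "(f + g) ^ (p ^ r) - (f ^ (p ^ r) + g ^ (p ^ r)) \<in> J"
proof (induction r)
  case 0 then show ?case using is_idealD(1)[OF J(1)] by simp
next
  case (Suc r)
  define u where "u = (f + g) ^ (p ^ r)"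
  define v where "v = f ^ (p ^ r) + g ^ (p ^ r)"
  have "u - v dvd u ^ p - v ^ p" by (simp add: power_diff_sumr2)
  then have "u ^ p - v ^ p \<in> J"
    using Suc is_idealD(4)[OF J(1)] unfolding u_def v_def by (auto elim!: dvdE)
  moreover have "v ^ p - ((f ^ (p ^ r)) ^ p + (g ^ (p ^ r)) ^ p) \<in> J"
    using prime_dvd_power_add_diff[OF p] J is_idealD(4)[OF J(1,2)] unfolding v_def by (metis dvdE)
  ultimately have "u ^ p - ((f ^ (p ^ r)) ^ p + (g ^ (p ^ r)) ^ p) \<in> J"
    using is_idealD(5)[OF J(1), of "u ^ p - v ^ p" "v ^ p - ((f ^ (p ^ r)) ^ p + (g ^ (p ^ r)) ^ p)"]
    by (simp add: algebra_simps)
  then show ?case unfolding u_def by (simp add: power_mult[symmetric] mult.commute)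
qed

text \<open>The elements fixed by the power map modulo \<open>J\<close> are closed under sums, by
  \<open>ideal_power_add\<close>, and under products. They contain the constants and
  \<open>[:0, 1:]\<close>, hence every polynomial.\<close>

lemma ideal_power_minus_self:
  fixes J :: "int poly set"
  assumes J: "is_ideal J" "of_nat p \<in> J" and p: "prime p"
    and X: "[:0, 1:] ^ (p ^ r) - [:0, 1:] \<in> J"
  shows "f ^ (p ^ r) - f \<in> J"
proof -
  define q where "q = p ^ r"
  note I = is_idealD[OF J(1)]
  have q0: "q > 0" using p prime_gt_0_nat unfolding q_def by auto
  have add: "(f + g) ^ q - (f + g) \<in> J" if "f ^ q - f \<in> J" "g ^ q - g \<in> J" for f g
    using I(5)[OF ideal_power_add[OF J p, of f g r] I(5)[OF that]] unfolding q_def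
    by (simp add: algebra_simps)
  have mult: "(f * g) ^ q - f * g \<in> J" if "f ^ q - f \<in> J" "g ^ q - g \<in> J" for f g
    using I(5)[OF I(4)[OF that(1), of "g ^ q"] I(3)[OF that(2), of f]]
    by (simp add: algebra_simps power_mult_distrib)
  have nat: "of_nat n ^ q - of_nat n \<in> J" for n
  proof (induction n)
    case 0 then show ?case using I(1) q0 by (simp add: zero_power)
  next
    case (Suc n) then show ?case using add[of 1 "of_nat n"] I(1) by (simp add: add.commute)
  qed
  \<comment> \<open>Modulo \<open>p\<close> a constant is a natural number, which is a sum of ones
    and therefore fixed.\<close>
  have const: "[:c:] ^ q - [:c:] \<in> J" for c
  proof -
    define n where "n = nat (c mod int p)"
    have n: "int n = c mod int p" unfolding n_def using p prime_gt_0_nat by simp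
    have "[:c:] - of_nat n = of_nat p * [:c div int p:]"
      by (simp add: of_nat_poly n mult.commute minus_mod_eq_mult_div)
    then have d: "[:c:] - of_nat n \<in> J" using I(4)[OF J(2)] by metis
    have "[:c:] - of_nat n dvd [:c:] ^ q - of_nat n ^ q" by (simp add: power_diff_sumr2)
    then have "[:c:] ^ q - of_nat n ^ q \<in> J" using d I(4) by (metis dvdE)
    from I(2)[OF I(5)[OF this nat[of n]] d]
    have "[:c:] ^ q - of_nat n ^ q + (of_nat n ^ q - of_nat n) - ([:c:] - of_nat n) \<in> J" .
    also have "[:c:] ^ q - of_nat n ^ q + (of_nat n ^ q - of_nat n) - ([:c:] - of_nat n) = [:c:] ^ q - [:c:]"
      by (simp only: diff_add_eq add_diff_eq diff_diff_eq diff_diff_eq2 diff_add_cancel add_diff_cancel add_diff_cancel_left')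
    finally show ?thesis .
  qed
  have "f ^ q - f \<in> J"
  proof (induction f)
    case 0 then show ?case using const[of 0] by simp
  next
    case (pCons a f)
    have "pCons a f = [:a:] + [:0, 1:] * f" by simp
    then show ?case using add[OF const mult[OF X[folded q_def] pCons(2)]] by metis
  qed
  then show ?thesis unfolding q_def .
qed

text \<open>Modulo \<open>p\<close>, a nonzero multiple of the monic \<open>g\<close> has degree at
  least that of \<open>g\<close>, whereas \<open>h\<close> stays nonzero and has smaller
  degree.\<close>

lemma monic_not_mem_ideal:
  fixes h g :: "int poly"
  assumes p: "prime p" and h: "degree h < degree g" "lead_coeff h = 1" and g: "lead_coeff g = 1"
  shows "h \<noteq> of_nat p * u + g * k"
proof
  assume eq: "h = of_nat p * u + g * k"
  have cu: "coeff (of_nat p * u) i = int p * coeff u i" for i by (simp add: of_nat_poly)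
  show False
  proof (cases "\<forall>i. int p dvd coeff k i")
    case True
    then have "int p dvd coeff (g * k) (degree h)"
      unfolding coeff_mult by (intro dvd_sum) simp
    then have "int p dvd coeff h (degree h)" unfolding eq coeff_add cu by simp
    then show False using h(2) p by simp
  next
    case False
    define S where "S = {i. \<not> int p dvd coeff k i}"
    have "i \<le> degree k" if "i \<in> S" for i
      using that le_degree[of k i] unfolding S_def by (cases "coeff k i = 0") auto
    then have fin: "finite S" by (meson finite_nat_set_iff_bounded_le)
    \<comment> \<open>\<open>m\<close> is the degree of \<open>k\<close> modulo \<open>p\<close>. As
      \<open>g\<close> is monic, the coefficient of \<open>g * k\<close> at
      \<open>degree g + m\<close> is congruent to that of \<open>k\<close> at \<open>m\<close>,
      while that of \<open>h\<close> is zero.\<close>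
    define m where "m = Max S"
    have m: "m \<in> S" "\<And>i. i > m \<Longrightarrow> int p dvd coeff k i"
      using Max_in[OF fin] Max_ge[OF fin] False unfolding m_def S_def by (blast, fastforce)
    have "coeff (g * k) (degree g + m) = (\<Sum>i\<le>degree g + m. coeff g i * coeff k (degree g + m - i))"
      by (simp add: coeff_mult)
    also have "\<dots> = coeff k m + (\<Sum>i\<in>{..degree g + m} - {degree g}. coeff g i * coeff k (degree g + m - i))"
      using g by (subst sum.remove[of _ "degree g"]) auto
    finally have 1: "coeff (g * k) (degree g + m) = \<dots>" .
    have "int p dvd coeff g i * coeff k (degree g + m - i)" if "i \<noteq> degree g" for i
      using m(2)[of "degree g + m - i"] coeff_eq_0[of g i] that
      by (cases "i < degree g") auto
    then have "int p dvd (\<Sum>i\<in>{..degree g + m} - {degree g}. coeff g i * coeff k (degree g + m - i))"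
      by (intro dvd_sum) blast
    moreover have z: "int p * coeff u (degree g + m) + coeff (g * k) (degree g + m) = 0"
      using h(1) eq cu coeff_eq_0[of h "degree g + m"] by (metis coeff_add trans_less_add1)
    ultimately have "int p dvd - (int p * coeff u (degree g + m) + (\<Sum>i\<in>{..degree g + m} - {degree g}. coeff g i * coeff k (degree g + m - i)))"
      by (simp only: dvd_minus_iff) (intro dvd_add dvd_triv_left)
    also have "\<dots> = coeff k m" using z unfolding 1 by linarith
    finally have "int p dvd coeff k m" .
    then show False using m(1) unfolding S_def by simp
  qed
qed

lemma degree_lead_coeff_X_power_diff:
  assumes "n > 1"
  shows "degree ([:0, 1::int:] ^ n - [:0, 1:]) = n \<and> lead_coeff ([:0, 1::int:] ^ n - [:0, 1:]) = 1"
proof -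
  have c: "coeff ([:0, 1::int:] ^ n - [:0, 1:]) i = (if i = n then 1 else 0) - (if i = 1 then 1 else 0)" for i
  proof -
    have 1: "[:0, 1::int:] ^ n = monom 1 n" using monom_altdef[of "1::int" n] by (simp only: smult_1_left)
    have 2: "[:0, 1::int:] = monom 1 1" using monom_altdef[of "1::int" 1] by (simp only: smult_1_left power_one_right)
    show ?thesis unfolding coeff_diff 1 by (subst 2) auto
  qed
  have "degree ([:0, 1::int:] ^ n - [:0, 1:]) = n"
    using assms by (intro antisym degree_le le_degree) (auto simp: c simp del: coeff_diff)
  then show ?thesis using assms by (simp add: c del: coeff_diff)
qed

lemma prime_ideal_of_degree:
  fixes p r :: nat
  assumes p: "prime p" and r: "r \<ge> 1"
  obtains J :: "int poly set" where "is_ideal J" "of_nat p \<in> J" "[:0, 1:] ^ (p ^ r) - [:0, 1:] \<in> J"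
    "\<And>x y. x * y \<in> J \<Longrightarrow> x \<in> J \<or> y \<in> J" "1 \<notin> J"
    "\<And>d. 1 \<le> d \<Longrightarrow> d < r \<Longrightarrow> [:0, 1:] ^ (p ^ d) - [:0, 1:] \<notin> J"
proof -
  define X :: "int poly" where "X = [:0, 1:]"
  have p1: "p > 1" using p prime_gt_1_nat by blast
  have deg: "degree (X ^ n - X) = n \<and> lead_coeff (X ^ n - X) = 1" if "n > 1" for n
    unfolding X_def using degree_lead_coeff_X_power_diff[OF that] .
  \<comment> \<open>An ideal containing \<open>p\<close> and \<open>X ^ (p ^ r) - X\<close> but not \<open>h\<close> has no residue field smaller than \<open>p ^ r\<close>; one exists
    since \<open>h\<close> is monic of degree below \<open>p ^ r\<close>, and is prime when maximal since \<open>h ^ (p ^ r)\<close> is congruent to \<open>h\<close>.\<close>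
  define h where "h = (\<Prod>d\<in>{1..<r}. X ^ (p ^ d) - X)"
  have pd: "p ^ d > 1" if "d \<ge> 1" for d using p1 that one_less_power[of p d] by simp
  have lh: "lead_coeff h = 1" unfolding h_def lead_coeff_prod
  proof (rule prod.neutral, rule ballI)
    fix d assume "d \<in> {1..<r}"
    then show "lead_coeff (X ^ p ^ d - X) = 1" using deg[OF pd[of d]] by auto
  qed
  have "degree h = (\<Sum>d\<in>{1..<r}. p ^ d)" unfolding h_def
  proof (subst degree_prod_eq_sum_degree)
    show "\<forall>d\<in>{1..<r}. X ^ p ^ d - X \<noteq> 0"
      using deg[OF pd] by (metis atLeastLessThan_iff leading_coeff_0_iff zero_neq_one)
    show "(\<Sum>d\<in>{1..<r}. degree (X ^ p ^ d - X)) = (\<Sum>d\<in>{1..<r}. p ^ d)"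
      using deg[OF pd] by (intro sum.cong) auto
  qed
  also have "\<dots> < p ^ r"
  proof -
    have "(\<Sum>d\<in>{1..<n}. p ^ d) < p ^ n" for n
    proof (induction n)
      case (Suc n)
      show ?case
      proof (cases "n = 0")
        case False
        then have "(\<Sum>d\<in>{1..<Suc n}. p ^ d) = (\<Sum>d\<in>{1..<n}. p ^ d) + p ^ n" by simp
        also have "\<dots> < 2 * p ^ n" using Suc by simp
        also have "\<dots> \<le> p * p ^ n" using p1 by (intro mult_right_mono) auto
        finally show ?thesis by simp
      qed (use p1 in auto)
    qed auto
    then show ?thesis .
  qed
  finally have dh: "degree h < p ^ r" .
  define g where "g = X ^ (p ^ r) - X"
  define I0 where "I0 = {of_nat p * u + g * k | u k. True}"
  have "degree h < degree g" "lead_coeff g = 1" using dh deg[OF pd[OF r]] unfolding g_def by auto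
  then have "h \<notin> I0" unfolding I0_def using monic_not_mem_ideal[OF p _ lh] by blast
  have I0: "is_ideal I0" unfolding is_ideal_def
  proof (intro conjI ballI allI)
    show "0 \<in> I0" unfolding I0_def by (auto intro: exI[of _ 0])
    fix x y assume "x \<in> I0"
    then obtain u k where x: "x = of_nat p * u + g * k" unfolding I0_def by blast
    have "y * x = of_nat p * (y * u) + g * (y * k)" unfolding x by (simp add: algebra_simps)
    then show "y * x \<in> I0" unfolding I0_def by blast
    assume "y \<in> I0"
    then obtain u' k' where y: "y = of_nat p * u' + g * k'" unfolding I0_def by blast
    have "x - y = of_nat p * (u - u') + g * (k - k')" unfolding x y by (simp add: algebra_simps)
    then show "x - y \<in> I0" unfolding I0_def by blast
  qed
  have "of_nat p * 1 + g * 0 \<in> I0" "of_nat p * 0 + g * 1 \<in> I0" unfolding I0_def by blast+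
  then have gens: "of_nat p \<in> I0" "g \<in> I0" by simp_all
  define \<J> where "\<J> = {J. is_ideal J \<and> I0 \<subseteq> J \<and> h \<notin> J}"
  have "\<exists>M\<in>\<J>. \<forall>J\<in>\<J>. M \<subseteq> J \<longrightarrow> J = M"
  proof (rule subset_Zorn_nonempty)
    show "\<J> \<noteq> {}" unfolding \<J>_def using I0 \<open>h \<notin> I0\<close> by blast
    fix C assume C: "C \<noteq> {}" "subset.chain \<J> C"
    have sub: "J \<in> \<J>" if "J \<in> C" for J using C that by (auto simp: subset.chain_def)
    have "is_ideal (\<Union>C)" unfolding is_ideal_def
    proof (intro conjI ballI allI)
      show "0 \<in> \<Union>C" using C(1) sub is_idealD(1) unfolding \<J>_def by blast
      fix x y assume "x \<in> \<Union>C"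
      then obtain J where J: "J \<in> C" "x \<in> J" by blast
      then show "y * x \<in> \<Union>C" using sub is_idealD(3) unfolding \<J>_def by blast
      assume "y \<in> \<Union>C"
      then obtain J' where J': "J' \<in> C" "y \<in> J'" by blast
      have "J \<subseteq> J' \<or> J' \<subseteq> J" using C(2) J J' by (auto simp: subset.chain_def)
      then show "x - y \<in> \<Union>C"
        using J J' sub is_idealD(2) unfolding \<J>_def by blast
    qed
    then show "\<Union>C \<in> \<J>" using C(1) sub unfolding \<J>_def by blast
  qed
  then obtain J where J\<J>: "J \<in> \<J>" and J_max: "\<And>J'. J' \<in> \<J> \<Longrightarrow> J \<subseteq> J' \<Longrightarrow> J' = J" by metis
  from J\<J> have J: "is_ideal J" "I0 \<subseteq> J" "h \<notin> J" unfolding \<J>_def by simp_all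
  have max: "J' = J" if "is_ideal J'" "J \<subseteq> J'" "h \<notin> J'" for J'
    by (rule J_max) (use that J in \<open>simp_all add: \<J>_def\<close>)
  note I = is_idealD[OF J(1)]
  \<comment> \<open>The ideal generated by \<open>J\<close> and \<open>a\<close> is strictly larger
    than \<open>J\<close>, so by maximality it contains \<open>h\<close>.\<close>
  have ext: "\<exists>j\<in>J. \<exists>y. h = j + a * y" if "a \<notin> J" for a
  proof (rule ccontr)
    assume con: "\<not> ?thesis"
    define J' where "J' = {j + a * y | j y. j \<in> J}"
    have "J' = J"
    proof (rule max)
      show "is_ideal J'" unfolding is_ideal_def
      proof (intro conjI ballI allI)
        show "0 \<in> J'" unfolding J'_def using I(1) by (auto intro!: exI[of _ 0])
        fix x y assume "x \<in> J'"
        then obtain j b where x: "x = j + a * b" "j \<in> J" unfolding J'_def by blast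
        have "y * x = y * j + a * (y * b)" unfolding x by (simp add: algebra_simps)
        then show "y * x \<in> J'" unfolding J'_def using I(3) x by blast
        assume "y \<in> J'"
        then obtain j' b' where y: "y = j' + a * b'" "j' \<in> J" unfolding J'_def by blast
        have "x - y = (j - j') + a * (b - b')" unfolding x y by (simp add: algebra_simps)
        then show "x - y \<in> J'" unfolding J'_def using I(2) x y by blast
      qed
      show "J \<subseteq> J'"
      proof
        fix j assume "j \<in> J"
        then have "j + a * 0 \<in> J'" unfolding J'_def by blast
        then show "j \<in> J'" by simp
      qed
      show "h \<notin> J'" using con unfolding J'_def by blast
    qed
    moreover have "0 + a * 1 \<in> J'" unfolding J'_def using I(1) by blast
    ultimately show False using that by simp
  qed
  have pow: "f ^ (p ^ r) - f \<in> J" for f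
    by (rule ideal_power_minus_self[OF J(1) _ p]) (use gens J(2) in \<open>auto simp: g_def X_def\<close>)
  show thesis
  proof (rule that[of J])
    show "is_ideal J" by (rule J)
    show "of_nat p \<in> J" "[:0, 1:] ^ (p ^ r) - [:0, 1:] \<in> J"
      using gens J(2) unfolding g_def X_def by auto
    show "1 \<notin> J" using I(3)[of 1 h] J(3) by auto
    show "x \<in> J \<or> y \<in> J" if xy: "x * y \<in> J" for x y
    proof (rule ccontr)
      assume "\<not> ?thesis"
      then obtain j u j' u' where "j \<in> J" "j' \<in> J" and h: "h = j + x * u" "h = j' + y * u'"
        using ext by blast
      \<comment> \<open>If neither factor lies in \<open>J\<close>, then \<open>h\<close> lies in
        both enlarged ideals, so \<open>h * h\<close> and all higher powers of \<open>h\<close> lie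
        in \<open>J\<close>, although one of them is congruent to \<open>h\<close>.\<close>
      have "h * h = j * (j' + y * u') + j' * (x * u) + (x * y) * (u * u')"
        by (subst h(1), subst h(2)) (simp add: algebra_simps)
      then have "h * h \<in> J" using I(4,5) \<open>j \<in> J\<close> \<open>j' \<in> J\<close> xy by simp
      moreover have "p ^ r = Suc (Suc (p ^ r - 2))" using pd[OF r] by simp
      then have "h ^ (p ^ r) = h * h * h ^ (p ^ r - 2)" by (metis mult.assoc power_Suc)
      ultimately have "h ^ (p ^ r) \<in> J" using I(4) by simp
      then show False using I(2)[OF _ pow[of h]] J(3) by fastforce
    qed
    show "[:0, 1:] ^ (p ^ d) - [:0, 1:] \<notin> J" if "1 \<le> d" "d < r" for d
    proof
      assume "[:0, 1:] ^ (p ^ d) - [:0, 1:] \<in> J"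
      moreover have "h = (X ^ (p ^ d) - X) * (\<Prod>d\<in>{1..<r} - {d}. X ^ (p ^ d) - X)"
        unfolding h_def using that by (subst prod.remove[of _ d]) auto
      ultimately show False using I(4) J(3) unfolding X_def by metis
    qed
  qed
qed

text \<open>The field is the quotient by the ideal of \<open>prime_ideal_of_degree\<close>. If
  \<open>d\<close> is the least degree of a monic element of \<open>J\<close>, the representatives
  are the polynomials of degree below \<open>d\<close> with coefficients in \<open>{0..<p}\<close>,
  so there are \<open>p ^ d\<close>. Root counting gives \<open>d \<le> r\<close>, and
  \<open>d < r\<close> would contradict the last property of the ideal by Fermat's theorem.\<close>

theorem residue_field_exists:
  assumes "primepow q"
  obtains J F :: "int poly set" where "residue_field J F" "card F = q"
proof -
  obtain p r where p: "prime p" and r: "r \<ge> 1" and q: "q = p ^ r"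
    using assms unfolding primepow_def by (metis One_nat_def Suc_leI)
  obtain J :: "int poly set" where J: "is_ideal J" "of_nat p \<in> J"
    and X: "[:0, 1:] ^ (p ^ r) - [:0, 1:] \<in> J"
    and prime: "\<And>x y. x * y \<in> J \<Longrightarrow> x \<in> J \<or> y \<in> J" and one: "1 \<notin> J"
    and sub: "\<And>d. 1 \<le> d \<Longrightarrow> d < r \<Longrightarrow> [:0, 1:] ^ (p ^ d) - [:0, 1:] \<notin> J"
    using prime_ideal_of_degree[OF p r] by metis
  note I = is_idealD[OF J(1)]
  have p1: "p > 1" using p prime_gt_1_nat by blast
  have smult: "smult c f \<in> J" if "f \<in> J" for c f using I(3)[OF that, of "[:c:]"] by simp
  define d where "d = (LEAST n. \<exists>g\<in>J. degree g = n \<and> lead_coeff g = 1)"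
  have q1: "p ^ r > 1" using p1 r one_less_power[of p r] by simp
  have "\<exists>n. \<exists>g\<in>J. degree g = n \<and> lead_coeff g = 1"
    using degree_lead_coeff_X_power_diff[OF q1] X by blast
  from LeastI_ex[OF this] have "\<exists>g\<in>J. degree g = d \<and> lead_coeff g = 1"
    unfolding d_def .
  then obtain g where g: "g \<in> J" "degree g = d" "lead_coeff g = 1" by blast
  have least: "d \<le> degree f" if "f \<in> J" "lead_coeff f = 1" for f
    unfolding d_def using that by (intro Least_le) blast
  have d1: "d \<ge> 1"
  proof (rule ccontr)
    assume "\<not> d \<ge> 1"
    then have "g = [:1:]" using g(2,3) by (cases g) (auto split: if_splits)
    then show False using g(1) one by (simp add: one_pCons)
  qed
  define L where "L = {xs :: int list. set xs \<subseteq> {0..<int p} \<and> length xs = d}"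
  define F where "F = Poly ` L"
  have L: "finite L" "card L = p ^ d"
    unfolding L_def by (simp_all add: finite_lists_length_eq card_lists_length_eq)
  have cF: "coeff (Poly xs) i = (if i < d then xs ! i else 0)" if "xs \<in> L" for xs i
    using that unfolding L_def by (simp add: nth_default_def)
  have "inj_on Poly L"
  proof (rule inj_onI)
    fix xs ys assume *: "xs \<in> L" "ys \<in> L" "Poly xs = Poly ys"
    then have "xs ! i = ys ! i" if "i < d" for i using cF[of xs i] cF[of ys i] that by simp
    then show "xs = ys" using * unfolding L_def by (auto intro: nth_equalityI)
  qed
  then have cardF: "finite F" "card F = p ^ d" unfolding F_def using L by (simp_all add: card_image)
  have red: "\<exists>f'. f - f' \<in> J \<and> (\<forall>i\<ge>d. coeff f' i = 0)" for f
  proof (induction f)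
    case 0 then show ?case using I(1) by (intro exI[of _ 0]) simp
  next
    case (pCons a f)
    then obtain f' where f': "f - f' \<in> J" "\<And>i. i \<ge> d \<Longrightarrow> coeff f' i = 0" by blast
    \<comment> \<open>Multiplication by \<open>[:0, 1:]\<close> raises the degree to at most
      \<open>d\<close>; subtracting a multiple of the monic \<open>g\<close> removes the top
      coefficient.\<close>
    define e where "e = coeff (pCons a f') d"
    have "pCons a f - (pCons a f' - smult e g) = [:0, 1:] * (f - f') + smult e g" by simp
    also have "\<dots> \<in> J" by (intro I(5) I(3) smult f' g)
    finally have "pCons a f - (pCons a f' - smult e g) \<in> J" .
    moreover have "coeff (pCons a f' - smult e g) i = 0" if "i \<ge> d" for i
    proof (cases "i = d")
      case True then show ?thesis using g by (simp add: e_def)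
    next
      case False
      then have "coeff (pCons a f') i = 0" using that f'(2)[of "i - 1"] by (cases i) auto
      then show ?thesis using False that g coeff_eq_0[of g i] by simp
    qed
    ultimately show ?case by blast
  qed
  interpret residue_field J F
  proof
    show "0 \<in> J" "1 \<notin> J" "finite F" using I(1) one cardF by auto
    show "x - y \<in> J" if "x \<in> J" "y \<in> J" for x y by (rule I(2)[OF that])
    show "y * x \<in> J" if "x \<in> J" for x y by (rule I(3)[OF that])
    show "x \<in> J \<or> y \<in> J" if "x * y \<in> J" for x y by (rule prime[OF that])
    show "\<exists>f\<in>F. x - f \<in> J" for x
    proof -
      obtain f where f: "x - f \<in> J" "\<And>i. i \<ge> d \<Longrightarrow> coeff f i = 0" using red by blast
      define xs where "xs = map (\<lambda>i. coeff f i mod int p) [0..<d]"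
      have xs: "xs \<in> L" unfolding xs_def L_def using p1 by auto
      have "f - Poly xs = of_nat p * map_poly (\<lambda>c. c div int p) f"
      proof (rule poly_eqI)
        fix i show "coeff (f - Poly xs) i = coeff (of_nat p * map_poly (\<lambda>c. c div int p) f) i"
          using f(2)[of i] cF[OF xs, of i]
          by (cases "i < d") (auto simp: xs_def of_nat_poly coeff_map_poly minus_mod_eq_mult_div)
      qed
      then have "f - Poly xs \<in> J" using I(4)[OF J(2)] by metis
      from I(5)[OF f(1) this] have "x - Poly xs \<in> J" by simp
      then show ?thesis using xs unfolding F_def by blast
    qed
    show "f = f'" if ff: "f \<in> F" "f' \<in> F" "f - f' \<in> J" for f f'
    proof (rule ccontr)
      assume ne: "f \<noteq> f'"
      define D where "D = f - f'"
      have D: "D \<noteq> 0" "D \<in> J" using ne ff unfolding D_def by auto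
      obtain xs ys where xy: "xs \<in> L" "ys \<in> L" "f = Poly xs" "f' = Poly ys"
        using ff unfolding F_def by blast
      define n where "n = degree D"
      define u where "u = coeff D n"
      have u0: "u \<noteq> 0" unfolding u_def n_def using D by simp
      have nd: "n < d" using u0 cF xy unfolding u_def D_def by (cases "n < d") auto
      have "xs ! n \<in> {0..<int p}" "ys ! n \<in> {0..<int p}"
        using xy nd nth_mem[of n xs] nth_mem[of n ys] unfolding L_def by (blast, force)
      moreover have "u = xs ! n - ys ! n" unfolding u_def D_def using xy cF nd by simp
      ultimately have "\<bar>u\<bar> < int p" by auto
      then have "\<not> int p dvd u" using u0 dvd_imp_le_int[of u "int p"] by auto
      then have "coprime u (int p)"
        using p prime_imp_coprime[of "int p" u] coprime_commute by auto
      then obtain v w where vw: "v * u + w * int p = 1"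
        by (metis bezout_int coprime_iff_gcd_eq_1)
      \<comment> \<open>The leading coefficient of \<open>D\<close> is invertible modulo
        \<open>p\<close>. Normalising it with the help of a multiple of \<open>p\<close> gives a
        monic element of \<open>J\<close> of degree below \<open>d\<close>.\<close>
      define D' where "D' = smult v D + of_nat p * monom w n"
      have "D' \<in> J" unfolding D'_def by (intro I(5) smult D I(4) J)
      have c: "coeff D' i = v * coeff D i + (if i = n then w * int p else 0)" for i
        unfolding D'_def by (simp add: of_nat_poly)
      have c1: "coeff D' n = 1" using c vw unfolding u_def by simp
      have "degree D' = n"
        using c c1 coeff_eq_0[of D] unfolding n_def
        by (intro antisym degree_le le_degree) auto
      then show False using least[OF \<open>D' \<in> J\<close>] c1 nd by simp
    qed
  qed
  \<comment> \<open>Every element is a root of \<open>P\<close>, so more than \<open>p ^ r\<close>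
    representatives would force the leading coefficient 1 into \<open>J\<close>.\<close>
  have "\<not> p ^ r < card F"
  proof
    assume *: "p ^ r < card F"
    define P :: "int poly poly" where "P = monom 1 (p ^ r) - monom 1 1"
    have "coeff P (p ^ r) \<in> J"
    proof (rule coeffs_mem_of_roots[OF _ cardF(1) *])
      show "degree P \<le> p ^ r" unfolding P_def
        using q1 by (intro degree_diff_le order_trans[OF degree_monom_le]) auto
      show "poly P x \<in> J" for x
        using ideal_power_minus_self[OF J p X, of x] unfolding P_def by (simp add: poly_monom)
    qed (use reps_unique in auto)
    then show False using q1 one unfolding P_def by simp
  qed
  then have "d \<le> r" using cardF p1 by (metis not_less power_strict_increasing)
  moreover have "\<not> d < r" using sub[OF d1] power_card_minus_self[of "[:0, 1:]"] cardF by auto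
  ultimately have "card F = q" using cardF q by simp
  then show thesis using that residue_field_axioms by blast
qed

section \<open>Algebraic dependence and interpolation\<close>

lemma sum_digits: "(\<Sum>i<n. (m div b ^ i mod b) * b ^ i) = m mod b ^ n" for m b :: nat
proof (induction n)
  case (Suc n)
  have "m mod b ^ Suc n = m mod (b ^ n * b)" by (simp add: mult.commute)
  also have "\<dots> = b ^ n * (m div b ^ n mod b) + m mod b ^ n" by (rule mod_mult2_eq)
  finally show ?case using Suc by (simp add: mult.commute)
qed simp

text \<open>
  With \<open>b = dependence_base r h\<close>, the \<open>b\<^bsup>Suc r\<^esup>\<close> monomials of degree below \<open>b\<close> in each of \<open>Suc r\<close> variables outnumber
  the points of a grid that detects their values at polynomials of degree \<open>h\<close> in \<open>r\<close> parameters.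
\<close>

definition dependence_base :: "nat \<Rightarrow> nat \<Rightarrow> nat" where
  "dependence_base r h = (Suc r * h + 1) ^ r + 1"

text \<open>The grid has at most \<open>(Suc r * h + 1) * b\<close> points in each direction, so its
  size is a constant times \<open>b ^ r\<close>, and \<open>b\<close> was chosen larger than that
  constant.\<close>

lemma dependence_base_count: "(Suc r * (dependence_base r h - 1) * h + 1) ^ r < dependence_base r h ^ Suc r"
proof -
  define b where "b = dependence_base r h"
  have b: "b = (Suc r * h + 1) ^ r + 1" unfolding b_def dependence_base_def ..
  then have b1: "b \<ge> 1" by simp
  have "Suc r * (b - 1) * h + 1 \<le> (Suc r * h + 1) * b"
  proof -
    have "Suc r * (b - 1) * h \<le> Suc r * b * h" by (intro mult_right_mono mult_left_mono) auto
    then have "Suc r * (b - 1) * h + 1 \<le> Suc r * b * h + b" using b1 by linarith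
    then show ?thesis by (simp add: algebra_simps)
  qed
  then have "(Suc r * (b - 1) * h + 1) ^ r \<le> ((Suc r * h + 1) * b) ^ r" by (rule power_mono) simp
  also have "\<dots> = (Suc r * h + 1) ^ r * b ^ r" by (rule power_mult_distrib)
  also have "\<dots> < b * b ^ r" using b b1 by (intro mult_strict_right_mono) auto
  finally show ?thesis unfolding b_def by simp
qed

context residue_field
begin

text \<open>Pigeonhole: there are more coefficient vectors for combinations of \<open>K\<close>
  monomials than tables of values on the grid. Two combinations thus agree on the grid after
  substitution of \<open>\<psi>\<close>, so their difference \<open>Q\<close> vanishes there and
  hence at all parameters. \<open>Q\<close> is nonzero as a function because the field has at least
  \<open>K\<close> elements.\<close>

lemma algebraic_dependence:
  fixes \<psi> :: "'w \<Rightarrow> ('v \<Rightarrow> 'a) \<Rightarrow> 'a"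
  assumes I: "finite I" "card I \<le> r" and W: "finite W" "card W > r"
    and \<psi>: "\<And>w. polyfun h (\<psi> w)"
    and q: "card F \<ge> dependence_base r h ^ Suc r" "card F > Suc r * (dependence_base r h - 1) * h"
  shows "\<exists>Q. polyfun (Suc r * (dependence_base r h - 1)) Q \<and> (\<exists>v. Q v \<notin> Z)
      \<and> (\<forall>v v'. (\<forall>w\<in>W. v w - v' w \<in> Z) \<longrightarrow> Q v - Q v' \<in> Z)
      \<and> (\<forall>u. (\<forall>i. i \<notin> I \<longrightarrow> u i = 0) \<longrightarrow> Q (\<lambda>w. \<psi> w u) \<in> Z)"
proof -
  define b where "b = dependence_base r h"
  define n where "n = Suc r"
  define K where "K = b ^ n"
  \<comment> \<open>\<open>d\<close> bounds the degree of \<open>Q\<close> after substitution of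
    \<open>\<psi>\<close>, so \<open>d + 1\<close> values for each parameter detect its
    vanishing.\<close>
  define d where "d = n * (b - 1) * h"
  have b: "b \<ge> 2" unfolding b_def dependence_base_def by simp
  have dK: "(d + 1) ^ r < K"
    unfolding d_def K_def n_def b_def by (rule dependence_base_count)
  have qK: "card F \<ge> K" and qd: "card F > d" using q unfolding K_def d_def n_def b_def by auto
  obtain W' where W': "W' \<subseteq> W" "card W' = n" "finite W'"
    using obtain_subset_with_card_n[of n W] W unfolding n_def by (metis Suc_leI finite_subset)
  obtain e where e: "bij_betw e {..<n} W'"
    using ex_bij_betw_nat_finite[OF W'(3)] W'(2) by (auto simp: atLeast0LessThan)
  \<comment> \<open>The exponents are the base-\<open>b\<close> digits of \<open>m\<close>, so \<open>v (e i) = t ^ (b ^ i)\<close> turns the monomial into \<open>t ^ m\<close>.\<close>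
  define mon where "mon m v = (\<Prod>i<n. v (e i) ^ (m div b ^ i mod b))" for m and v :: "'w \<Rightarrow> 'a"
  have polyfun_mon: "polyfun (n * (b - 1)) (mon m)" for m
  proof -
    have "polyfun (card {..<n} * (b - 1)) (\<lambda>v :: 'w \<Rightarrow> 'a. \<Prod>i<n. v (e i) ^ (m div b ^ i mod b))"
    proof (rule polyfun_prod)
      fix i
      have "m div b ^ i mod b < b" using b by (intro mod_less_divisor) simp
      then have le: "(m div b ^ i mod b) * 1 \<le> b - 1" by linarith
      show "polyfun (b - 1) (\<lambda>v :: 'w \<Rightarrow> 'a. v (e i) ^ (m div b ^ i mod b))"
        by (rule polyfun_mono[OF polyfun_power[OF polyfun.var] le]) simp
    qed
    then show ?thesis unfolding mon_def by simp
  qed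
  obtain X where X: "X \<subseteq> F" "card X = Suc d" "finite X"
    using obtain_subset_with_card_n[of "Suc d" F] qd finite_reps by (metis Suc_leI finite_subset)
  define conv where "conv g = (\<lambda>i. if i \<in> I then g i else 0)" for g :: "'v \<Rightarrow> 'a"
  define gr where "gr = PiE I (\<lambda>_. X)"
  have gr: "finite gr" "card gr \<le> (d + 1) ^ r"
  proof -
    show "finite gr" unfolding gr_def using I X by (intro finite_PiE) auto
    have "card gr = Suc d ^ card I" unfolding gr_def using I X by (simp add: card_PiE)
    also have "\<dots> \<le> Suc d ^ r" using I by (intro power_increasing) auto
    finally show "card gr \<le> (d + 1) ^ r" by simp
  qed
  define ev where "ev a u = (\<Sum>m<K. a m * mon m (\<lambda>w. \<psi> w u))" for a u
  define \<Phi> where "\<Phi> a = restrict (\<lambda>g. rep (ev a (conv g))) gr" for a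
  define AA where "AA = PiE {..<K} (\<lambda>_. F)"
  have "\<not> inj_on \<Phi> AA"
  proof (rule pigeonhole)
    have "\<Phi> ` AA \<subseteq> PiE gr (\<lambda>_. F)" unfolding \<Phi>_def using rep(1) by auto
    then have "card (\<Phi> ` AA) \<le> card (PiE gr (\<lambda>_. F))"
      using gr finite_reps by (intro card_mono finite_PiE) auto
    also have "\<dots> = card F ^ card gr" using card_PiE[OF gr(1), of "\<lambda>_. F"] by simp
    also have "\<dots> < card F ^ K"
    proof (rule power_strict_increasing)
      show "card gr < K" using gr dK by linarith
      have "b \<le> b ^ n" using b unfolding n_def by (intro self_le_power) auto
      then show "1 < card F" using qK b unfolding K_def by linarith
    qed
    also have "\<dots> = card AA" unfolding AA_def by (simp add: card_PiE)
    finally show "card (\<Phi> ` AA) < card AA" .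
  qed
  then obtain a a' where aa: "a \<in> AA" "a' \<in> AA" "\<Phi> a = \<Phi> a'" "a \<noteq> a'" unfolding inj_on_def by blast
  define c where "c m = a m - a' m" for m
  define Q where "Q v = (\<Sum>m<K. c m * mon m v)" for v
  have polyfun_Q: "polyfun (n * (b - 1)) Q" unfolding Q_def
    by (intro polyfun_sum polyfun.mult[OF polyfun.const[of 0] polyfun_mon]) simp
  have "\<exists>m<K. c m \<notin> Z"
  proof (rule ccontr)
    assume "\<not> ?thesis"
    then have "a m = a' m" if "m < K" for m
      using that aa(1,2) reps_unique[of "a m" "a' m"] unfolding c_def AA_def by (auto simp: PiE_iff)
    then have "a = a'" using aa(1,2) unfolding AA_def by (intro PiE_ext) auto
    then show False using aa by simp
  qed
  then obtain m0 where m0: "m0 < K" "c m0 \<notin> Z" by blast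
  have "\<exists>v. Q v \<notin> Z"
  proof (rule ccontr)
    assume "\<not> ?thesis"
    then have all: "Q v \<in> Z" for v by blast
    define P where "P = (\<Sum>m<K. monom (c m) m)"
    have cP: "coeff P i = (if i < K then c i else 0)" for i
      unfolding P_def by (simp add: coeff_sum)
    have "coeff P m0 \<in> Z"
    proof (rule coeffs_mem_of_roots[of P "K - 1" F])
      show "degree P \<le> K - 1" by (intro degree_le) (auto simp: cP)
      show "K - 1 < card F" using qK m0(1) by linarith
      fix t :: 'a
      define v where "v w = t ^ (b ^ the_inv_into {..<n} e w)" for w
      have "mon m v = t ^ m" if "m < K" for m
      proof -
        have "mon m v = (\<Prod>i<n. t ^ ((m div b ^ i mod b) * b ^ i))"
          unfolding mon_def v_def using e the_inv_into_f_f[of e "{..<n}"]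
          by (intro prod.cong) (auto simp: bij_betw_def power_mult[symmetric] mult.commute)
        also have "\<dots> = t ^ (\<Sum>i<n. (m div b ^ i mod b) * b ^ i)" by (simp add: power_sum)
        also have "(\<Sum>i<n. (m div b ^ i mod b) * b ^ i) = m"
          using that unfolding sum_digits K_def by simp
        finally show ?thesis .
      qed
      then have "poly P t = Q v" unfolding P_def Q_def poly_sum by (simp add: poly_monom)
      then show "poly P t \<in> Z" using all by simp
    qed (use finite_reps reps_unique in auto)
    then show False using m0 cP by simp
  qed
  moreover have "Q v - Q v' \<in> Z" if "\<forall>w\<in>W. v w - v' w \<in> Z" for v v'
    unfolding Q_def mon_def
    using that W'(1) e by (intro sum_cong mult_cong prod_cong power_cong)
      (auto simp: zero bij_betw_def)
  moreover have "Q (\<lambda>w. \<psi> w u) \<in> Z" if u: "\<forall>i. i \<notin> I \<longrightarrow> u i = 0" for u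
  proof (rule polyfun_zero_of_grid[of d "\<lambda>u. Q (\<lambda>w. \<psi> w u)" I X "\<lambda>_. 0"])
    show "x = y" if "x \<in> X" "y \<in> X" "x - y \<in> Z" for x y
      using that X(1) reps_unique by blast
    show "polyfun d (\<lambda>u. Q (\<lambda>w. \<psi> w u))" unfolding d_def by (rule polyfun_compose[OF polyfun_Q \<psi>])
    fix u' assume u': "\<And>i. i \<in> I \<Longrightarrow> u' i \<in> X" "\<And>i. i \<notin> I \<Longrightarrow> u' i = 0"
    define g where "g = restrict u' I"
    have g: "g \<in> gr" "conv g = u'" unfolding g_def gr_def conv_def using u' by auto
    have "rep (ev a u') = rep (ev a' u')" using fun_cong[OF aa(3), of g] g unfolding \<Phi>_def by simp
    then have "ev a u' - ev a' u' \<in> Z" by (simp add: rep_eq_iff)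
    also have "ev a u' - ev a' u' = Q (\<lambda>w. \<psi> w u')"
      unfolding ev_def Q_def c_def by (simp add: sum_subtractf left_diff_distrib)
    finally show "Q (\<lambda>w. \<psi> w u') \<in> Z" .
  qed (use I X u in auto)
  ultimately show ?thesis using polyfun_Q unfolding n_def b_def by blast
qed

end

text \<open>Here \<open>\<delta>\<close> plays the role of the inverse of the product of all differences, so that no division is needed.\<close>

definition lagrange_basis :: "'a::comm_ring_1 \<Rightarrow> ('h \<Rightarrow> 'a) \<Rightarrow> 'h set \<Rightarrow> 'h \<Rightarrow> 'a poly" where
  "lagrange_basis \<delta> \<kappa> H h =
     smult (\<delta> * (\<Prod>h1\<in>H - {h}. \<Prod>h2\<in>H - {h1}. \<kappa> h1 - \<kappa> h2)) (\<Prod>h'\<in>H - {h}. [:- \<kappa> h', 1:])"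

lemma degree_prod_linear: "degree (\<Prod>h\<in>A. [:- \<kappa> h, 1::'a::comm_ring_1:]) \<le> card A"
proof (induction A rule: infinite_finite_induct)
  case (insert x A)
  have "degree ([:- \<kappa> x, 1:] * (\<Prod>h\<in>A. [:- \<kappa> h, 1:])) \<le> degree [:- \<kappa> x, 1:] + degree (\<Prod>h\<in>A. [:- \<kappa> h, 1:])"
    by (rule degree_mult_le)
  also have "\<dots> \<le> 1 + card A" using insert by (intro add_mono) auto
  finally show ?case using insert by simp
qed auto

lemma polyfun_coeff_prod_linear:
  assumes "\<And>h. polyfun 1 (\<kappa> h)"
  shows "polyfun (card A) (\<lambda>u. coeff (\<Prod>h\<in>A. [:- \<kappa> h u, 1:]) i)"
proof (induction A arbitrary: i rule: infinite_finite_induct)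
  case (insert x A)
  have "coeff ([:- \<kappa> x u, 1:] * (\<Prod>h\<in>A. [:- \<kappa> h u, 1:])) i = - \<kappa> x u * coeff (\<Prod>h\<in>A. [:- \<kappa> h u, 1:]) i
    + (if i = 0 then 0 else coeff (\<Prod>h\<in>A. [:- \<kappa> h u, 1:]) (i - 1))" for u
    by (cases i) simp_all
  moreover have "polyfun (1 + card A) (\<lambda>u. - \<kappa> x u * coeff (\<Prod>h\<in>A. [:- \<kappa> h u, 1:]) i)"
    by (intro polyfun_mult polyfun_uminus assms insert)
  moreover have "polyfun (1 + card A) (\<lambda>u. if i = 0 then 0 else coeff (\<Prod>h\<in>A. [:- \<kappa> h u, 1:]) (i - 1))"
    by (cases "i = 0") (auto intro: polyfun.const polyfun_mono[OF insert.IH])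
  ultimately have "polyfun (1 + card A) (\<lambda>u. coeff ([:- \<kappa> x u, 1:] * (\<Prod>h\<in>A. [:- \<kappa> h u, 1:])) i)"
    by (simp only: polyfun.add)
  then show ?case using insert(1,2) by (simp del: mult_pCons_left)
qed (auto intro: polyfun.const)

text \<open>The three summands bound the degrees of \<open>\<delta>\<close>, of the product of
  differences and of the nodal product.\<close>

lemma polyfun_coeff_lagrange_basis:
  assumes "\<And>h. polyfun 1 (\<kappa> h)" "polyfun 1 \<delta>" "finite H"
  shows "polyfun (1 + card H * card H + card H) (\<lambda>u. coeff (lagrange_basis (\<delta> u) (\<lambda>h. \<kappa> h u) H h) i)"
proof -
  have le: "card (H - {h}) \<le> card H" for h using assms(3) by (simp add: card_mono)
  have "polyfun (card (H - {h}) * card H) (\<lambda>u. \<Prod>h1\<in>H - {h}. \<Prod>h2\<in>H - {h1}. \<kappa> h1 u - \<kappa> h2 u)"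
  proof (rule polyfun_prod)
    fix h1
    have "polyfun (card (H - {h1}) * 1) (\<lambda>u. \<Prod>h2\<in>H - {h1}. \<kappa> h1 u - \<kappa> h2 u)"
      by (rule polyfun_prod) (intro polyfun_diff assms)
    then show "polyfun (card H) (\<lambda>u. \<Prod>h2\<in>H - {h1}. \<kappa> h1 u - \<kappa> h2 u)" by (rule polyfun_mono) (simp add: le)
  qed
  then have "polyfun (card H * card H) (\<lambda>u. \<Prod>h1\<in>H - {h}. \<Prod>h2\<in>H - {h1}. \<kappa> h1 u - \<kappa> h2 u)"
    by (rule polyfun_mono) (simp add: le)
  moreover have "polyfun (card H) (\<lambda>u. coeff (\<Prod>h'\<in>H - {h}. [:- \<kappa> h' u, 1:]) i)"
    by (rule polyfun_mono[OF polyfun_coeff_prod_linear[of \<kappa>, OF assms(1)] le])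
  ultimately show ?thesis unfolding lagrange_basis_def coeff_smult
    by (intro polyfun_mult assms(2))
qed

context residue_field
begin

text \<open>As \<open>\<delta>\<close> inverts the product of all differences, the scalar in
  \<open>lagrange_basis\<close> inverts the product of the differences at \<open>h\<close>, so the
  basis is dual to the nodes. \<open>P\<close> minus its interpolant then has more roots than its
  degree allows.\<close>

lemma lagrange_interpolation:
  assumes H: "finite H" and P: "degree P < card H"
    and sep: "\<And>h h'. h \<in> H \<Longrightarrow> h' \<in> H \<Longrightarrow> \<kappa> h - \<kappa> h' \<in> Z \<Longrightarrow> h = h'"
    and \<delta>: "\<delta> * (\<Prod>h\<in>H. \<Prod>h'\<in>H - {h}. \<kappa> h - \<kappa> h') - 1 \<in> Z"
  shows "coeff P i - (\<Sum>h\<in>H. poly P (\<kappa> h) * coeff (lagrange_basis \<delta> \<kappa> H h) i) \<in> Z"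
proof -
  define R where "R = P - (\<Sum>h\<in>H. smult (poly P (\<kappa> h)) (lagrange_basis \<delta> \<kappa> H h))"
  have deg: "degree (lagrange_basis \<delta> \<kappa> H h) \<le> card H - 1" if "h \<in> H" for h
    unfolding lagrange_basis_def using degree_prod_linear[of \<kappa> "H - {h}"] that H
    by (intro order_trans[OF degree_smult_le]) (simp add: card_Diff_singleton)
  have "coeff R i \<in> Z"
  proof (rule coeffs_mem_of_roots[of R "card H - 1" "\<kappa> ` H"])
    show "degree R \<le> card H - 1" unfolding R_def using P deg
      by (intro degree_diff_le degree_sum_le H order_trans[OF degree_smult_le]) auto
    have "inj_on \<kappa> H" using sep zero by (auto intro!: inj_onI)
    then have "card (\<kappa> ` H) = card H" by (rule card_image)
    then show "card H - 1 < card (\<kappa> ` H)" using P by simp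
    fix x assume "x \<in> \<kappa> ` H"
    then obtain h where h: "h \<in> H" "x = \<kappa> h" by blast
    have other: "poly (lagrange_basis \<delta> \<kappa> H h') (\<kappa> h) = 0" if "h' \<in> H - {h}" for h'
    proof -
      have "(\<Prod>h''\<in>H - {h'}. \<kappa> h - \<kappa> h'') = 0" using that h H by (intro prod_zero) auto
      then show ?thesis unfolding lagrange_basis_def by (simp add: poly_prod)
    qed
    have "poly (lagrange_basis \<delta> \<kappa> H h) (\<kappa> h)
      = \<delta> * ((\<Prod>h1\<in>H - {h}. \<Prod>h2\<in>H - {h1}. \<kappa> h1 - \<kappa> h2) * (\<Prod>h'\<in>H - {h}. \<kappa> h - \<kappa> h'))"
      unfolding lagrange_basis_def by (simp add: poly_prod mult.assoc)
    also have "\<dots> = \<delta> * (\<Prod>h\<in>H. \<Prod>h'\<in>H - {h}. \<kappa> h - \<kappa> h')"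
      using prod.remove[OF H h(1), of "\<lambda>h. \<Prod>h'\<in>H - {h}. \<kappa> h - \<kappa> h'"] by (simp add: mult.commute)
    finally have self: "poly (lagrange_basis \<delta> \<kappa> H h) (\<kappa> h) - 1 \<in> Z" using \<delta> by simp
    have "poly R x = poly P (\<kappa> h) - poly P (\<kappa> h) * poly (lagrange_basis \<delta> \<kappa> H h) (\<kappa> h)"
      unfolding R_def h(2) by (simp add: poly_sum sum.remove[OF H h(1)] other)
    also have "\<dots> = - (poly P (\<kappa> h) * (poly (lagrange_basis \<delta> \<kappa> H h) (\<kappa> h) - 1))"
      by (simp add: algebra_simps)
    also have "\<dots> \<in> Z" by (intro uminus mult self)
    finally show "poly R x \<in> Z" .
  qed (use H sep in auto)
  then show ?thesis unfolding R_def by (simp add: coeff_sum)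
qed

end

section \<open>The incidence relation\<close>

text \<open>
  A linear form in the coordinates \<open>x\<^sub>c, \<dots>, x\<^bsub>a-1\<^esub>, y\<^sub>0, \<dots>, y\<^bsub>l-1\<^esub>\<close>, with the powers of \<open>w\<close> as coefficients: among
  enough values of \<open>w\<close>, one gives a form that separates any given small set of points.
\<close>

definition lin_form :: "nat \<Rightarrow> nat \<Rightarrow> nat \<Rightarrow> 'a::comm_ring_1 \<Rightarrow> (nat \<Rightarrow> 'a) \<Rightarrow> (nat \<Rightarrow> 'a) \<Rightarrow> 'a" where
  "lin_form a l c w x y = (\<Sum>j<a - c + l. w ^ j * (if j < a - c then x (c + j) else y (j - (a - c))))"

text \<open>A sum of \<open>U\<close> polynomials of degree below \<open>E\<close>, each in one
  linear form. If the form for \<open>v\<close> takes distinct values on \<open>E\<close> edges,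
  their equations determine the block \<open>C v\<close> from the other blocks by
  interpolation.\<close>

definition edge_fun :: "nat \<Rightarrow> nat \<Rightarrow> nat \<Rightarrow> nat \<Rightarrow> nat \<Rightarrow> (nat \<Rightarrow> 'a::comm_ring_1) \<Rightarrow>
    (nat \<Rightarrow> nat \<Rightarrow> 'a) \<Rightarrow> (nat \<Rightarrow> 'a) \<Rightarrow> (nat \<Rightarrow> 'a) \<Rightarrow> 'a" where
  "edge_fun a l c U E \<omega> C x y = (\<Sum>v<U. \<Sum>i<E. C v i * lin_form a l c (\<omega> v) x y ^ i)"

definition incident :: "'a::comm_ring_1 set \<Rightarrow> nat \<Rightarrow> nat \<Rightarrow> nat \<Rightarrow> nat \<Rightarrow> nat \<Rightarrow> (nat \<Rightarrow> 'a) \<Rightarrow>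
    (nat \<Rightarrow> nat \<Rightarrow> nat \<Rightarrow> 'a) \<Rightarrow> (nat \<Rightarrow> 'a) \<Rightarrow> (nat \<Rightarrow> 'a) \<Rightarrow> bool" where
  "incident Z a l c U E \<omega> C x y \<longleftrightarrow> (\<forall>i<c. x i - edge_fun a l c U E \<omega> (C i) x y \<in> Z)"

lemma lin_form_cong:
  assumes "\<And>i. c \<le> i \<Longrightarrow> i < a \<Longrightarrow> x i = x' i" "\<And>i. i < l \<Longrightarrow> y i = y' i"
  shows "lin_form a l c w x y = lin_form a l c w x' y'"
  unfolding lin_form_def using assms by (intro sum.cong) auto

lemma polyfun_lin_form:
  assumes "\<And>i. polyfun 1 (x i)" "\<And>i. polyfun 1 (y i)"
  shows "polyfun 1 (\<lambda>u. lin_form a l c w (\<lambda>i. x i u) (\<lambda>i. y i u))"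
  unfolding lin_form_def
proof (rule polyfun_sum)
  fix j
  have "polyfun 1 (\<lambda>u. if j < a - c then x (c + j) u else y (j - (a - c)) u)"
    using assms by (cases "j < a - c") auto
  then show "polyfun 1 (\<lambda>u. w ^ j * (if j < a - c then x (c + j) u else y (j - (a - c)) u))"
    by (rule polyfun.mult[OF polyfun.const[of 0]]) simp
qed

text \<open>Parameters: the coefficients outside one block, the coordinates of the vertices, and \<open>\<delta>\<close> for interpolation.\<close>

datatype 'b param = Coef nat nat nat | Coord "'b \<times> nat" | Inv

text \<open>Variables of the relation \<open>Q\<close>: \<open>Inl\<close> for the coefficients,
  \<open>Inr\<close> for one coordinate of each centre.\<close>

type_synonym rel_index = "(nat \<times> nat \<times> nat) + nat"

definition rel_point :: "(nat \<Rightarrow> nat \<Rightarrow> nat \<Rightarrow> 'a) \<Rightarrow> (nat \<Rightarrow> 'a) \<Rightarrow> rel_index \<Rightarrow> 'a" where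
  "rel_point C \<theta> w = (case w of Inl (i, v, j) \<Rightarrow> C i v j | Inr j \<Rightarrow> \<theta> j)"

text \<open>The first bracket bounds the degree of the interpolated values, the second that of the
  Lagrange coefficients at \<open>E\<close> nodes.\<close>

definition interpolation_degree :: "nat \<Rightarrow> nat" where
  "interpolation_degree E = (1 + E) + (1 + E * E + E)"

context residue_field
begin

text \<open>\<open>H\<close> indexes the edges and \<open>V\<close> the vertex coordinates of a
  configuration. Interpolation at the values of the form \<open>v0\<close> expresses the
  \<open>c * E\<close> coefficients of that block through the other blocks, the coordinates and one
  inverse. By \<open>count\<close> these parameters are fewer than the \<open>c * U * E + n\<close>
  variables of the relation. \<open>Q\<close> precedes \<open>C\<close> and \<open>X\<close>, so it
  serves all configurations of the same shape.\<close>

lemma configuration_relation: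
  fixes mx ny :: "'h \<Rightarrow> 'b" and th :: "nat \<Rightarrow> 'b \<times> nat"
  assumes v0: "v0 < U" and H: "finite H" "card H = E" "E > 0" and V: "finite V" and ca: "c \<le> a"
    and mx: "\<And>h i. h \<in> H \<Longrightarrow> i < a \<Longrightarrow> (mx h, i) \<in> V"
    and ny: "\<And>h i. h \<in> H \<Longrightarrow> i < l \<Longrightarrow> (ny h, i) \<in> V"
    and th: "\<And>j. j < n \<Longrightarrow> th j \<in> V"
    and count: "card V + 1 < c * E + n"
    and r: "r = c * U * E + n - 1"
    and q: "card F \<ge> dependence_base r (interpolation_degree E) ^ Suc r"
      "card F > Suc r * (dependence_base r (interpolation_degree E) - 1) * interpolation_degree E"
  shows "\<exists>Q. polyfun (Suc r * (dependence_base r (interpolation_degree E) - 1)) Q \<and> (\<exists>v. Q v \<notin> Z) \<and>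
    (\<forall>C X. (\<forall>h\<in>H. incident Z a l c U E \<omega> C (X (mx h)) (X (ny h))) \<longrightarrow>
      (\<forall>h\<in>H. \<forall>h'\<in>H. lin_form a l c (\<omega> v0) (X (mx h)) (X (ny h))
          - lin_form a l c (\<omega> v0) (X (mx h')) (X (ny h')) \<in> Z \<longrightarrow> h = h') \<longrightarrow>
      Q (rel_point C (\<lambda>j. X (fst (th j)) (snd (th j)))) \<in> Z)"
proof -
  define W :: "rel_index set" where "W = Inl ` ({..<c} \<times> {..<U} \<times> {..<E}) \<union> Inr ` {..<n}"
  define I0 where "I0 = {..<c} \<times> ({..<U} - {v0}) \<times> {..<E}"
  define I where "I = (\<lambda>(i, v, j). Coef i v j) ` I0 \<union> Coord ` V \<union> {Inv}"
  have "card W = card ({..<c} \<times> {..<U} \<times> {..<E}) + card {..<n}"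
    unfolding W_def by (subst card_Un_disjoint) (auto simp: card_image)
  then have cW: "finite W" "card W = c * U * E + n" unfolding W_def by (auto simp: mult.assoc)
  have "card I \<le> card I0 + card V + 1"
  proof -
    have "card I \<le> card ((\<lambda>(i, v, j). Coef i v j :: 'b param) ` I0 \<union> Coord ` V) + card {Inv :: 'b param}"
      unfolding I_def by (rule card_Un_le)
    also have "\<dots> \<le> card ((\<lambda>(i, v, j). Coef i v j :: 'b param) ` I0) + card (Coord ` V) + 1"
      using card_Un_le[of "(\<lambda>(i, v, j). Coef i v j :: 'b param) ` I0" "Coord ` V"] by simp
    also have "\<dots> \<le> card I0 + card V + 1"
      using card_image_le[of I0 "\<lambda>(i, v, j). Coef i v j :: 'b param"] card_image_le[OF V, of Coord]
      unfolding I0_def by simp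
    finally show ?thesis .
  qed
  moreover have I0E: "card I0 + c * E = c * U * E"
  proof -
    have "card I0 = c * ((U - 1) * E)" unfolding I0_def using v0 by (simp add: card_cartesian_product)
    moreover have "U * E = (U - 1) * E + E" using v0 by (cases U) auto
    ultimately show ?thesis by (metis add_mult_distrib2 mult.assoc)
  qed
  ultimately have cI: "finite I" "card I \<le> r"
    using count r V unfolding I_def I0_def by auto
  have rW: "r < card W" using cW count r I0E by linarith
  define \<kappa> where "\<kappa> v h u = lin_form a l c (\<omega> v) (\<lambda>i. u (Coord (mx h, i))) (\<lambda>i. u (Coord (ny h, i)))"
    for v h and u :: "'b param \<Rightarrow> 'a"
  have polyfun_\<kappa>: "polyfun 1 (\<kappa> v h)" for v h
    unfolding \<kappa>_def by (intro polyfun_lin_form polyfun.var) auto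
  \<comment> \<open>What an edge equation leaves for the block \<open>v0\<close> once the other
    blocks are subtracted: the value to be interpolated at the node
    \<open>\<kappa> v0 h\<close>.\<close>
  define rest where "rest i h u = u (Coord (mx h, i)) - (\<Sum>v\<in>{..<U} - {v0}. \<Sum>j<E. u (Coef i v j) * \<kappa> v h u ^ j)"
    for i h and u :: "'b param \<Rightarrow> 'a"
  define \<psi> :: "rel_index \<Rightarrow> ('b param \<Rightarrow> 'a) \<Rightarrow> 'a" where "\<psi> w u = (case w of
      Inl (i, v, j) \<Rightarrow> if v = v0 then
          (\<Sum>h\<in>H. rest i h u * coeff (lagrange_basis (u Inv) (\<lambda>h. \<kappa> v0 h u) H h) j)
        else u (Coef i v j)
    | Inr j \<Rightarrow> u (Coord (th j)))" for w u
  have polyfun_rest: "polyfun (1 + E) (rest i h)" for i h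
    unfolding rest_def
  proof (intro polyfun_diff polyfun_sum)
    fix v j assume "j \<in> {..<E}"
    then have "j * 1 \<le> E" by simp
    then show "polyfun (1 + E) (\<lambda>u. u (Coef i v j) * \<kappa> v h u ^ j)"
      by (intro polyfun_mult polyfun.var polyfun_mono[OF polyfun_power[OF polyfun_\<kappa>]]) auto
  qed (auto intro: polyfun.var)
  have polyfun_\<psi>: "polyfun (interpolation_degree E) (\<psi> w)" for w
  proof (cases w)
    case (Inl p)
    obtain i v j where p: "p = (i, v, j)" by (cases p) auto
    show ?thesis
    proof (cases "v = v0")
      case True
      have "polyfun ((1 + E) + (1 + card H * card H + card H))
          (\<lambda>u. rest i h u * coeff (lagrange_basis (u Inv) (\<lambda>h. \<kappa> v0 h u) H h) j)" for h
        by (intro polyfun_mult polyfun_rest polyfun_coeff_lagrange_basis polyfun_\<kappa> polyfun.var H) auto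
      then show ?thesis unfolding \<psi>_def Inl p interpolation_degree_def H(2) using True by (simp add: polyfun_sum)
    next
      case False
      then show ?thesis unfolding \<psi>_def Inl p interpolation_degree_def by (simp add: polyfun.var)
    qed
  next
    case (Inr j)
    then show ?thesis unfolding \<psi>_def interpolation_degree_def by (simp add: polyfun.var)
  qed
  obtain Q where Q: "polyfun (Suc r * (dependence_base r (interpolation_degree E) - 1)) Q" "\<exists>v. Q v \<notin> Z"
    and Q_cong: "\<And>v v'. (\<forall>w\<in>W. v w - v' w \<in> Z) \<Longrightarrow> Q v - Q v' \<in> Z"
    and Q_zero: "\<And>u. (\<forall>i. i \<notin> I \<longrightarrow> u i = 0) \<Longrightarrow> Q (\<lambda>w. \<psi> w u) \<in> Z"
    using algebraic_dependence[OF cI cW(1) rW, of "interpolation_degree E" \<psi>, OF polyfun_\<psi> q] by blast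
  have "Q (rel_point C (\<lambda>j. X (fst (th j)) (snd (th j)))) \<in> Z"
    if inc: "\<forall>h\<in>H. incident Z a l c U E \<omega> C (X (mx h)) (X (ny h))"
      and sep: "\<forall>h\<in>H. \<forall>h'\<in>H. lin_form a l c (\<omega> v0) (X (mx h)) (X (ny h))
          - lin_form a l c (\<omega> v0) (X (mx h')) (X (ny h')) \<in> Z \<longrightarrow> h = h'" for C X
  proof -
    define K where "K v h = lin_form a l c (\<omega> v) (X (mx h)) (X (ny h))" for v h
    have "(\<Prod>h\<in>H. \<Prod>h'\<in>H - {h}. K v0 h - K v0 h') \<notin> Z"
      using sep H unfolding K_def by (auto simp: prod_mem_iff)
    then obtain \<delta> where \<delta>: "(\<Prod>h\<in>H. \<Prod>h'\<in>H - {h}. K v0 h - K v0 h') * \<delta> - 1 \<in> Z"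
      by (rule inverse_exists)
    \<comment> \<open>The parameter point of the given configuration; it is zero outside
      \<open>I\<close>, as \<open>Q_zero\<close> demands.\<close>
    define u where "u w = (if w \<in> I then (case w of Coef i v j \<Rightarrow> C i v j
      | Coord p \<Rightarrow> X (fst p) (snd p) | Inv \<Rightarrow> \<delta>) else 0)" for w
    have u_Coef: "u (Coef i v j) = C i v j" if "i < c" "v < U" "v \<noteq> v0" "j < E" for i v j
      unfolding u_def I_def I0_def using that by (force simp: image_iff)
    have u_Coord: "u (Coord p) = X (fst p) (snd p)" if "p \<in> V" for p
      unfolding u_def I_def using that by auto
    have u_Inv: "u Inv = \<delta>" unfolding u_def I_def by simp
    have \<kappa>_eq: "\<kappa> v h u = K v h" if "h \<in> H" for v h
      unfolding \<kappa>_def K_def using that by (intro lin_form_cong) (auto simp: u_Coord mx ny)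
    have main: "C i v0 j - \<psi> (Inl (i, v0, j)) u \<in> Z" if ij: "i < c" "j < E" for i j
    proof -
      define P where "P = (\<Sum>j<E. monom (C i v0 j) j)"
      have cP: "coeff P k = (if k < E then C i v0 k else 0)" for k
        unfolding P_def by (simp add: coeff_sum)
      have "degree P \<le> E - 1" by (intro degree_le) (auto simp: cP)
      then have "degree P < card H" using H by simp
      from lagrange_interpolation[OF H(1) this, of "K v0" \<delta> j]
      have "coeff P j - (\<Sum>h\<in>H. poly P (K v0 h) * coeff (lagrange_basis \<delta> (K v0) H h) j) \<in> Z"
        using sep \<delta> unfolding K_def by (simp add: mult.commute)
      moreover have "(\<Sum>h\<in>H. poly P (K v0 h) * coeff (lagrange_basis \<delta> (K v0) H h) j)
          - \<psi> (Inl (i, v0, j)) u \<in> Z"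
      proof -
        have "lagrange_basis \<delta> (\<lambda>h. \<kappa> v0 h u) H h = lagrange_basis \<delta> (K v0) H h" if "h \<in> H" for h
          unfolding lagrange_basis_def using that \<kappa>_eq by (auto intro!: arg_cong2[where f = smult] prod.cong arg_cong2[where f = "(*)"])
        then have \<psi>_eq: "\<psi> (Inl (i, v0, j)) u = (\<Sum>h\<in>H. rest i h u * coeff (lagrange_basis \<delta> (K v0) H h) j)"
          unfolding \<psi>_def u_Inv by (simp cong: sum.cong)
        show ?thesis unfolding \<psi>_eq
        proof (intro sum_cong mult_cong)
          fix h assume h: "h \<in> H"
          have eq0: "X (mx h) i - edge_fun a l c U E \<omega> (C i) (X (mx h)) (X (ny h)) \<in> Z"
            using inc h ij unfolding incident_def by blast
          have eq1: "edge_fun a l c U E \<omega> (C i) (X (mx h)) (X (ny h))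
             = poly P (K v0 h) + (\<Sum>v\<in>{..<U} - {v0}. \<Sum>j<E. C i v j * K v h ^ j)"
            unfolding edge_fun_def P_def K_def[symmetric] using v0
            by (subst sum.remove[of _ v0]) (auto simp: poly_sum poly_monom)
          have eq2: "rest i h u = X (mx h) i - (\<Sum>v\<in>{..<U} - {v0}. \<Sum>j<E. C i v j * K v h ^ j)"
            unfolding rest_def using h ij ca mx
            by (intro arg_cong2[where f = "(-)"] sum.cong) (auto simp: u_Coord u_Coef \<kappa>_eq)
          have "rest i h u - poly P (K v0 h) \<in> Z" using eq0 unfolding eq1 eq2 by (simp add: algebra_simps)
          then show "poly P (K v0 h) - rest i h u \<in> Z" using diff_commute by blast
        qed (simp add: zero)
      qed
      ultimately have "coeff P j - \<psi> (Inl (i, v0, j)) u \<in> Z" by (rule diff_trans)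
      then show ?thesis using ij by (simp add: cP)
    qed
    have "rel_point C (\<lambda>j. X (fst (th j)) (snd (th j))) w - \<psi> w u \<in> Z" if w: "w \<in> W" for w
    proof (cases w)
      case (Inl p)
      obtain i v j where p: "p = (i, v, j)" by (cases p) auto
      then have b: "i < c" "v < U" "j < E" using w Inl unfolding W_def by auto
      show ?thesis
      proof (cases "v = v0")
        case True
        then show ?thesis using main b Inl p by (simp add: rel_point_def)
      next
        case False
        then show ?thesis using b u_Coef unfolding Inl p rel_point_def \<psi>_def by (simp add: zero)
      qed
    next
      case (Inr j)
      then have "th j \<in> V" using w th unfolding W_def by auto
      then show ?thesis unfolding Inr rel_point_def \<psi>_def by (simp add: u_Coord zero)
    qed
    then have "Q (rel_point C (\<lambda>j. X (fst (th j)) (snd (th j)))) - Q (\<lambda>w. \<psi> w u) \<in> Z"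
      by (intro Q_cong) auto
    moreover have "Q (\<lambda>w. \<psi> w u) \<in> Z" by (intro Q_zero) (simp add: u_def)
    ultimately show ?thesis using mem_cong by blast
  qed
  then show ?thesis using Q by blast
qed

end

section \<open>Separating the edges of a configuration by a linear form\<close>

context residue_field
begin

lemma lin_form_mem_cong:
  assumes "\<And>i. c \<le> i \<Longrightarrow> i < a \<Longrightarrow> x i - x' i \<in> Z" "\<And>i. i < l \<Longrightarrow> y i - y' i \<in> Z"
  shows "lin_form a l c w x y - lin_form a l c w x' y' \<in> Z"
  unfolding lin_form_def using assms by (intro sum_cong mult_cong) (auto simp: zero)

text \<open>The first \<open>c\<close> coordinates are functions of those entering the linear forms,
  so distinct edges already differ in the latter.\<close>

lemma incident_determines:
  assumes "incident Z a l c U E \<omega> C x y" "incident Z a l c U E \<omega> C x' y'"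
    and "\<And>i. c \<le> i \<Longrightarrow> i < a \<Longrightarrow> x i - x' i \<in> Z" "\<And>i. i < l \<Longrightarrow> y i - y' i \<in> Z" "i < a"
  shows "x i - x' i \<in> Z"
proof (cases "i < c")
  case True
  have "edge_fun a l c U E \<omega> (C i) x y - edge_fun a l c U E \<omega> (C i) x' y' \<in> Z"
    unfolding edge_fun_def by (intro sum_cong mult_cong power_cong lin_form_mem_cong assms) (simp_all add: zero)
  moreover have "x i - edge_fun a l c U E \<omega> (C i) x y \<in> Z" "edge_fun a l c U E \<omega> (C i) x' y' - x' i \<in> Z"
    using assms(1,2) True diff_commute unfolding incident_def by blast+
  ultimately show ?thesis using diff_trans by blast
qed (use assms in auto)

text \<open>As a function of \<open>w\<close>, the difference of the forms at two distinct points is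
  a nonzero polynomial of degree at most \<open>a + l\<close>. Each pair thus excludes at most
  \<open>a + l\<close> indices, and \<open>U\<close> exceeds the total over all pairs.\<close>

lemma separating_form:
  assumes H: "finite H" and \<omega>: "\<And>v v'. v < U \<Longrightarrow> v' < U \<Longrightarrow> \<omega> v - \<omega> v' \<in> Z \<Longrightarrow> v = v'"
    and U: "U > card H * card H * (a + l)"
    and dist: "\<And>h h'. h \<in> H \<Longrightarrow> h' \<in> H \<Longrightarrow> h \<noteq> h' \<Longrightarrow>
      (\<exists>i. c \<le> i \<and> i < a \<and> x h i - x h' i \<notin> Z) \<or> (\<exists>i<l. y h i - y h' i \<notin> Z)"
  shows "\<exists>v<U. \<forall>h\<in>H. \<forall>h'\<in>H. lin_form a l c (\<omega> v) (x h) (y h) - lin_form a l c (\<omega> v) (x h') (y h') \<in> Z \<longrightarrow> h = h'"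
proof (rule ccontr)
  assume con: "\<not> ?thesis"
  define B where "B = (\<lambda>(h, h'). {v\<in>{..<U}. h \<noteq> h' \<and>
    lin_form a l c (\<omega> v) (x h) (y h) - lin_form a l c (\<omega> v) (x h') (y h') \<in> Z})"
  have B: "card (B (h, h')) \<le> a + l" if h: "h \<in> H" "h' \<in> H" for h h'
  proof (cases "h = h'")
    case True then show ?thesis unfolding B_def by simp
  next
    case False
    define p where "p h j = (if j < a - c then x h (c + j) else y h (j - (a - c)))" for h j
    define P where "P = (\<Sum>j<a - c + l. monom (p h j - p h' j) j)"
    have cP: "coeff P j = (if j < a - c + l then p h j - p h' j else 0)" for j
      unfolding P_def by (simp add: coeff_sum)
    have "degree P \<le> a + l" by (intro degree_le) (auto simp: cP)
    have eval: "poly P w = lin_form a l c w (x h) (y h) - lin_form a l c w (x h') (y h')" for w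
      unfolding P_def lin_form_def p_def
      by (simp add: poly_sum poly_monom sum_subtractf[symmetric] algebra_simps cong: sum.cong)
    obtain j where j: "j < a - c + l" "p h j - p h' j \<notin> Z"
      using dist[OF h False]
    proof (elim disjE exE conjE)
      fix i assume "c \<le> i" "i < a" "x h i - x h' i \<notin> Z"
      then have "p h (i - c) = x h i" "p h' (i - c) = x h' i" "i - c < a - c + l" unfolding p_def by auto
      then show thesis using that[of "i - c"] \<open>x h i - x h' i \<notin> Z\<close> by simp
    next
      fix i assume "i < l" "y h i - y h' i \<notin> Z"
      then have "p h (i + (a - c)) = y h i" "p h' (i + (a - c)) = y h' i" unfolding p_def by auto
      then show thesis using that[of "i + (a - c)"] \<open>i < l\<close> \<open>y h i - y h' i \<notin> Z\<close> by simp
    qed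
    show ?thesis
    proof (rule ccontr)
      assume big: "\<not> ?thesis"
      have "inj_on \<omega> (B (h, h'))" using \<omega> zero unfolding B_def by (auto intro!: inj_onI)
      then have "card (\<omega> ` B (h, h')) > a + l" using big by (simp add: card_image)
      then have "coeff P j \<in> Z"
      proof (rule coeffs_mem_of_roots[OF \<open>degree P \<le> a + l\<close>, rotated])
        show "poly P w \<in> Z" if "w \<in> \<omega> ` B (h, h')" for w
          using that unfolding B_def eval by auto
        show "w = w'" if w: "w \<in> \<omega> ` B (h, h')" "w' \<in> \<omega> ` B (h, h')" "w - w' \<in> Z" for w w'
        proof -
          obtain v v' where "v < U" "v' < U" "w = \<omega> v" "w' = \<omega> v'" using w(1,2) unfolding B_def by auto
          then show ?thesis using \<omega> w(3) by blast
        qed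
      qed (simp add: B_def)
      then show False using j cP by simp
    qed
  qed
  have "{..<U} \<subseteq> (\<Union>e\<in>H \<times> H. B e)" using con unfolding B_def by fastforce
  then have "card {..<U} \<le> card (\<Union>e\<in>H \<times> H. B e)"
    using H unfolding B_def by (intro card_mono finite_UN_I) (auto split: prod.splits)
  also have "\<dots> \<le> (\<Sum>e\<in>H \<times> H. card (B e))" using H by (intro card_UN_le) auto
  also have "\<dots> \<le> (\<Sum>e\<in>H \<times> H. a + l)" using B by (intro sum_mono) auto
  also have "\<dots> = card H * card H * (a + l)" by (simp add: card_cartesian_product)
  finally show False using U by simp
qed

end

section \<open>Labels and coordinates of spiders with common leaves\<close>

text \<open>Position \<open>m\<close>, counted from the leaf, on leg \<open>i\<close> of spider
  \<open>j\<close>. A leaf is common to all spiders and a centre to all its legs, so the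
  corresponding index is normalised to 0.\<close>

definition spider_label :: "nat \<Rightarrow> nat \<Rightarrow> nat \<Rightarrow> nat \<Rightarrow> nat \<times> nat \<times> nat" where
  "spider_label k i j m = (if m = 0 then (i, 0, 0) else if m = 2 * k then (0, j, m) else (i, j, m))"

text \<open>Edge \<open>m\<close> of a leg joins positions \<open>m\<close> and
  \<open>Suc m\<close>. Leaves and centres sit at even positions, so parity decides the part in
  which an end lies.\<close>

definition even_end :: "nat \<Rightarrow> nat" where "even_end m = (if even m then m else Suc m)"
definition odd_end :: "nat \<Rightarrow> nat" where "odd_end m = (if even m then Suc m else m)"

definition M_end :: "bool \<Rightarrow> nat \<Rightarrow> nat \<times> nat \<times> nat \<Rightarrow> nat \<times> nat \<times> nat" where
  "M_end b k = (\<lambda>(i, j, m). spider_label k i j (if b then even_end m else odd_end m))"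
definition N_end :: "bool \<Rightarrow> nat \<Rightarrow> nat \<times> nat \<times> nat \<Rightarrow> nat \<times> nat \<times> nat" where
  "N_end b k = (\<lambda>(i, j, m). spider_label k i j (if b then odd_end m else even_end m))"

text \<open>Even positions carry \<open>d0\<close> coordinates and odd ones \<open>d1\<close>. The
  four sets belong to the leaves, the centres, the odd positions and the inner even
  positions.\<close>

definition spider_coords :: "nat \<Rightarrow> nat \<Rightarrow> nat \<Rightarrow> nat \<Rightarrow> nat \<Rightarrow> ((nat \<times> nat \<times> nat) \<times> nat) set" where
  "spider_coords k s n d0 d1 =
     (\<lambda>(i, z). ((i, 0, 0), z)) ` ({..<s} \<times> {..<d0}) \<union>
     (\<lambda>(j, z). ((0, j, 2 * k), z)) ` ({..<n} \<times> {..<d0}) \<union>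
     (\<lambda>(i, j, p, z). ((i, j, 2 * p + 1), z)) ` ({..<s} \<times> {..<n} \<times> {..<k} \<times> {..<d1}) \<union>
     (\<lambda>(i, j, p, z). ((i, j, 2 * p + 2), z)) ` ({..<s} \<times> {..<n} \<times> {..<k - 1} \<times> {..<d0})"

lemma finite_spider_coords: "finite (spider_coords k s n d0 d1)"
  unfolding spider_coords_def by auto

text \<open>The leaves are paid for once; the factor of \<open>n\<close> is the cost of one more
  spider, later compared with its \<open>2 * k * s * c\<close> equations.\<close>

lemma card_spider_coords:
  "card (spider_coords k s n d0 d1) \<le> s * d0 + n * (d0 * (1 + s * (k - 1)) + d1 * (s * k))"
proof -
  have "card (spider_coords k s n d0 d1) \<le> card ({..<s} \<times> {..<d0}) + card ({..<n} \<times> {..<d0})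
    + card ({..<s} \<times> {..<n} \<times> {..<k} \<times> {..<d1}) + card ({..<s} \<times> {..<n} \<times> {..<k - 1} \<times> {..<d0})"
    unfolding spider_coords_def
    by (intro order_trans[OF card_Un_le] add_mono card_image_le) auto
  also have "\<dots> = s * d0 + n * (d0 * (1 + s * (k - 1)) + d1 * (s * k))"
    by (simp only: card_cartesian_product card_lessThan) (simp add: algebra_simps)
  finally show ?thesis .
qed

lemma spider_label_mem_coords:
  assumes "i < s" "j < n" "m \<le> 2 * k" "z < (if even m then d0 else d1)"
  shows "(spider_label k i j m, z) \<in> spider_coords k s n d0 d1"
proof -
  consider "m = 0" | "m = 2 * k" "m \<noteq> 0" | "odd m" "m < 2 * k" | "even m" "0 < m" "m < 2 * k"
    using assms(3) by fastforce
  then show ?thesis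
  proof cases
    case 1 then show ?thesis using assms unfolding spider_label_def spider_coords_def by force
  next
    case 2 then show ?thesis using assms unfolding spider_label_def spider_coords_def by force
  next
    case 3
    then obtain p where "m = 2 * p + 1" by (elim oddE)
    then have "((i, j, m), z) \<in> (\<lambda>(i, j, p, z). ((i, j, 2 * p + 1), z)) ` ({..<s} \<times> {..<n} \<times> {..<k} \<times> {..<d1})"
      using 3 assms by (intro image_eqI[of _ _ "(i, j, p, z)"]) auto
    moreover have "spider_label k i j m = (i, j, m)" using 3 unfolding spider_label_def by auto
    ultimately show ?thesis unfolding spider_coords_def by auto
  next
    case 4
    then obtain p where p: "m = 2 * p" by (elim evenE)
    then have "((i, j, m), z) \<in> (\<lambda>(i, j, p, z). ((i, j, 2 * p + 2), z)) ` ({..<s} \<times> {..<n} \<times> {..<k - 1} \<times> {..<d0})"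
      using 4 assms by (intro image_eqI[of _ _ "(i, j, p - 1, z)"]) auto
    moreover have "spider_label k i j m = (i, j, m)" using 4 unfolding spider_label_def by auto
    ultimately show ?thesis unfolding spider_coords_def by auto
  qed
qed

section \<open>Choice of the coefficients\<close>

text \<open>
  \<open>t\<close> spiders with common leaves, one leg of length \<open>2 * k\<close> for each \<open>i < s\<close>, spelled out as coordinate
  vectors attached to the labels \<open>spider_label\<close>. The flag \<open>b\<close> says whether the leaves and centres lie in
  the part \<open>M\<close> (dimension \<open>a\<close>) or in the part \<open>N\<close> (dimension \<open>l\<close>).
\<close>

definition spider_configuration :: "'a::comm_ring_1 set \<Rightarrow> 'a set \<Rightarrow> nat \<Rightarrow> nat \<Rightarrow> ((nat \<Rightarrow> 'a) \<Rightarrow> (nat \<Rightarrow> 'a) \<Rightarrow> bool) \<Rightarrow>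
    nat \<Rightarrow> nat \<Rightarrow> nat \<Rightarrow> bool \<Rightarrow> (nat \<times> nat \<times> nat \<Rightarrow> nat \<Rightarrow> 'a) \<Rightarrow> bool" where
  "spider_configuration Z F a l adj k s t b X \<longleftrightarrow>
    (\<forall>j<t. \<forall>z < (if b then a else l). X (0, j, 2 * k) z \<in> F) \<and>
    (\<forall>j<t. \<forall>j'<t. j \<noteq> j' \<longrightarrow> (\<exists>z < (if b then a else l). X (0, j, 2 * k) z \<noteq> X (0, j', 2 * k) z)) \<and>
    (\<forall>h\<in>{..<s} \<times> {..<t} \<times> {..<2 * k}. adj (X (M_end b k h)) (X (N_end b k h))) \<and>
    (\<forall>h\<in>{..<s} \<times> {..<t} \<times> {..<2 * k}. \<forall>h'\<in>{..<s} \<times> {..<t} \<times> {..<2 * k}. h \<noteq> h' \<longrightarrow>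
      (\<exists>z<a. X (M_end b k h) z - X (M_end b k h') z \<notin> Z) \<or>
      (\<exists>z<l. X (N_end b k h) z - X (N_end b k h') z \<notin> Z))"

context residue_field
begin

text \<open>\<open>dimM\<close> and \<open>dimN\<close> treat the two possible sides of the leaves:
  a spider has no more coordinates than equations. In \<open>n\<close>, the term
  \<open>l * s\<close> pays for the leaves, and the 2 for the inverse parameter and a strict
  inequality. \<open>E\<close> counts the edges of \<open>n\<close> spiders, and \<open>T\<close>
  bounds the number of centres when each coordinate takes at most \<open>U * D + n * n\<close>
  values.\<close>

lemma exists_coefficients:
  fixes a l c k s n E U r D T :: nat and \<omega> :: "nat \<Rightarrow> 'a"
  assumes pos: "k \<ge> 1" "s \<ge> 1" and ca: "c \<le> a" and al: "a \<le> l"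
    and dimM: "a * (1 + s * (k - 1)) + l * (s * k) \<le> 2 * k * s * c"
    and dimN: "l * (1 + s * (k - 1)) + a * (s * k) \<le> 2 * k * s * c"
    and n: "n = l * s + 2" and E: "E = s * (n * (2 * k))" and U: "U = E * E * (a + l) + 1"
    and \<omega>: "\<And>v v'. v < U \<Longrightarrow> v' < U \<Longrightarrow> \<omega> v - \<omega> v' \<in> Z \<Longrightarrow> v = v'"
    and r: "r = c * U * E + n - 1"
    and D: "D = Suc r * (dependence_base r (interpolation_degree E) - 1)"
    and q: "card F \<ge> dependence_base r (interpolation_degree E) ^ Suc r" "card F > D * interpolation_degree E"
      "card F > 2 * l * U * D + n * n"
    and T: "T = (U * D + n * n) ^ l"
  shows "\<exists>C. \<forall>b X t. T < t \<longrightarrow> \<not> spider_configuration Z F a l (incident Z a l c U E \<omega> C) k s t b X"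
proof -
  define H where "H = {..<s} \<times> {..<n} \<times> {..<2 * k}"
  define d0 where "d0 b = (if b then a else l)" for b
  define d1 where "d1 b = (if b then l else a)" for b
  define V where "V b = spider_coords k s n (d0 b) (d1 b)" for b
  have H: "finite H" "card H = E" "E > 0"
    unfolding H_def E using pos n by (auto simp: card_cartesian_product)
  have count: "card (V b) + 1 < c * E + n" for b
  proof -
    have "d0 b * (1 + s * (k - 1)) + d1 b * (s * k) \<le> 2 * k * s * c"
      using dimM dimN unfolding d0_def d1_def by (cases b) auto
    then have "n * (d0 b * (1 + s * (k - 1)) + d1 b * (s * k)) \<le> n * (2 * k * s * c)"
      by (rule mult_left_mono) simp
    moreover have "s * d0 b \<le> l * s" using al unfolding d0_def by auto
    moreover have "c * E = n * (2 * k * s * c)" unfolding E by (simp add: algebra_simps)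
    ultimately show ?thesis
      using card_spider_coords[of k s n "d0 b" "d1 b"] n unfolding V_def by linarith
  qed
  have le: "even_end m \<le> 2 * k" "odd_end m \<le> 2 * k" "even (even_end m)" "odd (odd_end m)" if "m < 2 * k" for m
    using that unfolding even_end_def odd_end_def by (auto elim!: oddE)
  have mem: "(M_end b k h, z) \<in> V b" if "h \<in> H" "z < a" for b h z
    using that le unfolding H_def M_end_def V_def d0_def d1_def
    by (auto intro!: spider_label_mem_coords split: if_splits)
  have nem: "(N_end b k h, z) \<in> V b" if "h \<in> H" "z < l" for b h z
    using that le unfolding H_def N_end_def V_def d0_def d1_def
    by (auto intro!: spider_label_mem_coords split: if_splits)
  have th: "((0, j, 2 * k), z) \<in> V b" if "j < n" "z < d0 b" for j z b
    using that spider_label_mem_coords[of 0 s j n "2 * k" k z "d0 b" "d1 b"] pos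
    unfolding V_def spider_label_def by auto
  \<comment> \<open>A relation for \<open>n\<close> spiders with centres on the side given by
    \<open>b\<close>, read off in coordinate \<open>z\<close>, provided that the form
    \<open>v0\<close> separates their edges.\<close>
  define good where "good b z v0 Q \<longleftrightarrow> polyfun D Q \<and> (\<exists>v. Q v \<notin> Z) \<and>
    (\<forall>C X. (\<forall>h\<in>H. incident Z a l c U E \<omega> C (X (M_end b k h)) (X (N_end b k h))) \<longrightarrow>
      (\<forall>h\<in>H. \<forall>h'\<in>H. lin_form a l c (\<omega> v0) (X (M_end b k h)) (X (N_end b k h))
          - lin_form a l c (\<omega> v0) (X (M_end b k h')) (X (N_end b k h')) \<in> Z \<longrightarrow> h = h') \<longrightarrow>
      Q (rel_point C (\<lambda>j. X (0, j, 2 * k) z)) \<in> Z)" for b z v0 Q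
  have ex: "\<exists>Q. good b z v0 Q" if "z < d0 b" "v0 < U" for b z v0
    using configuration_relation[OF that(2) H finite_spider_coords ca, of "M_end b k" k s n "d0 b" "d1 b"
        l "N_end b k" n "\<lambda>j. ((0, j, 2 * k), z)" r \<omega>, folded V_def] mem nem th[OF _ that(1)] count r q D
    unfolding good_def by simp
  define Q where "Q b z v0 = (SOME Q. good b z v0 Q)" for b z v0
  have Q: "good b z v0 (Q b z v0)" if "z < d0 b" "v0 < U" for b z v0
    unfolding Q_def by (rule someI_ex[OF ex[OF that]])
  \<comment> \<open>One point is chosen off the relations for all sides, coordinates and forms at
    once; the \<open>Inr\<close> entries keep its centre values distinct.\<close>
  define A :: "(bool \<times> nat \<times> nat + nat \<times> nat) set" where
    "A = Inl ` {(b, z, v). z < d0 b \<and> v < U} \<union> Inr ` {(j, j'). j < j' \<and> j' < n}"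
  define f :: "bool \<times> nat \<times> nat + nat \<times> nat \<Rightarrow> (rel_index \<Rightarrow> 'a) \<Rightarrow> 'a" where
    "f p = (case p of Inl (b, z, v) \<Rightarrow> Q b z v | Inr (j, j') \<Rightarrow> (\<lambda>v. v (Inr j) - v (Inr j')))" for p
  define deg :: "bool \<times> nat \<times> nat + nat \<times> nat \<Rightarrow> nat" where "deg p = (case p of Inl _ \<Rightarrow> D | Inr _ \<Rightarrow> 1)" for p
  have sub1: "{(b, z, v). z < d0 b \<and> v < U} \<subseteq> UNIV \<times> {..<l} \<times> {..<U}"
    using al unfolding d0_def by (auto split: if_splits)
  have sub2: "{(j, j'). j < j' \<and> j' < n} \<subseteq> {..<n} \<times> {..<n}" by auto
  have fin: "finite {(b, z, v). z < d0 b \<and> v < U}" "finite {(j, j'). j < j' \<and> j' < n}"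
    by (rule finite_subset[OF sub1], simp) (rule finite_subset[OF sub2], simp)
  have cards: "card {(b, z, v). z < d0 b \<and> v < U} \<le> 2 * l * U" "card {(j, j'). j < j' \<and> j' < n} \<le> n * n"
    using card_mono[OF _ sub1] card_mono[OF _ sub2] by (simp_all add: card_cartesian_product)
  have finA: "finite A" unfolding A_def using fin by auto
  have "sum deg A = (\<Sum>p\<in>{(b, z, v). z < d0 b \<and> v < U}. D) + (\<Sum>p\<in>{(j, j'). j < j' \<and> j' < n}. 1)"
    unfolding A_def using fin
    by (subst sum.union_disjoint) (auto simp: sum.reindex deg_def)
  also have "\<dots> \<le> 2 * l * U * D + n * n" using cards by (auto intro!: add_mono)
  finally have sum_deg: "sum deg A < card F" using q by linarith
  have "\<exists>v. \<forall>p\<in>A. f p v \<notin> Z"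
  proof (rule polyfun_prod_nonzero[OF finA _ _ sum_deg])
    fix p assume p: "p \<in> A"
    show "polyfun (deg p) (f p)"
      using p Q unfolding A_def f_def deg_def good_def by (auto intro!: polyfun_diff polyfun.var)
    show "\<exists>v. f p v \<notin> Z"
    proof (cases p)
      case (Inl e) then show ?thesis using p Q unfolding A_def f_def good_def by auto
    next
      case (Inr e)
      then obtain j j' where e: "e = (j, j')" "j < j'" using p unfolding A_def by auto
      then have "f p (\<lambda>w. if w = Inr j then 1 else 0) = 1" unfolding f_def Inr by simp
      then show ?thesis using one by metis
    qed
  qed
  then obtain v where v: "\<And>p. p \<in> A \<Longrightarrow> f p v \<notin> Z" by blast
  define C where "C i u j = v (Inl (i, u, j))" for i u j
  define \<theta>0 where "\<theta>0 j = v (Inr j)" for j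
  have v_eq: "rel_point C \<theta>0 = v"
    unfolding rel_point_def C_def \<theta>0_def by (auto split: sum.splits)
  have vQ: "Q b z v0 (rel_point C \<theta>0) \<notin> Z" if "z < d0 b" "v0 < U" for b z v0
    using v[of "Inl (b, z, v0)"] that unfolding v_eq A_def f_def by auto
  have v\<theta>: "\<theta>0 j - \<theta>0 j' \<notin> Z" if "j < j'" "j' < n" for j j'
    using v[of "Inr (j, j')"] that unfolding A_def f_def \<theta>0_def by auto
  show ?thesis
  proof (intro exI[of _ C] allI impI notI)
    fix b X t
    assume t: "T < t" and "spider_configuration Z F a l (incident Z a l c U E \<omega> C) k s t b X"
    then have XF: "\<forall>j<t. \<forall>z < (if b then a else l). X (0, j, 2 * k) z \<in> F"
      and cdist: "\<forall>j<t. \<forall>j'<t. j \<noteq> j' \<longrightarrow> (\<exists>z < (if b then a else l). X (0, j, 2 * k) z \<noteq> X (0, j', 2 * k) z)"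
      and inc: "\<forall>h\<in>{..<s} \<times> {..<t} \<times> {..<2 * k}. incident Z a l c U E \<omega> C (X (M_end b k h)) (X (N_end b k h))"
      and edist: "\<forall>h\<in>{..<s} \<times> {..<t} \<times> {..<2 * k}. \<forall>h'\<in>{..<s} \<times> {..<t} \<times> {..<2 * k}. h \<noteq> h' \<longrightarrow>
        (\<exists>z<a. X (M_end b k h) z - X (M_end b k h') z \<notin> Z) \<or>
        (\<exists>z<l. X (N_end b k h) z - X (N_end b k h') z \<notin> Z)"
      unfolding spider_configuration_def by simp_all
    define D2 where "D2 = U * D + n * n"
    define S where "S z = (\<lambda>j. X (0, j, 2 * k) z) ` {..<t}" for z
    \<comment> \<open>Otherwise every coordinate would take at most \<open>D2\<close> values on the
      centres, leaving room for at most \<open>T\<close> of them.\<close>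
    have "\<exists>z < d0 b. card (S z) > D2"
    proof (rule ccontr)
      assume con: "\<not> ?thesis"
      define g where "g j = restrict (\<lambda>z. X (0, j, 2 * k) z) {..<d0 b}" for j
      have "inj_on g {..<t}"
      proof (rule inj_onI, rule ccontr)
        fix j j' assume j: "j \<in> {..<t}" "j' \<in> {..<t}" "g j = g j'" "j \<noteq> j'"
        then obtain z where z: "z < d0 b" "X (0, j, 2 * k) z \<noteq> X (0, j', 2 * k) z"
          using cdist unfolding d0_def by blast
        then show False using fun_cong[OF j(3), of z] unfolding g_def by simp
      qed
      then have "t = card (g ` {..<t})" by (simp add: card_image)
      also have "\<dots> \<le> card (PiE {..<d0 b} S)"
        by (intro card_mono finite_PiE) (auto simp: g_def S_def split: if_splits)
      also have "\<dots> = (\<Prod>z<d0 b. card (S z))" by (simp add: card_PiE)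
      also have "\<dots> \<le> (\<Prod>z<d0 b. D2)" using con by (intro prod_mono conjI) (auto intro: leI)
      also have "\<dots> = D2 ^ d0 b" by simp
      also have "\<dots> \<le> D2 ^ l"
        using al n unfolding D2_def d0_def by (intro power_increasing) auto
      finally show False using t unfolding T D2_def by simp
    qed
    then obtain z where z: "z < d0 b" "card (S z) > D2" by blast
    have SF: "S z \<subseteq> F" using XF z(1) unfolding S_def d0_def by auto
    \<comment> \<open>Which form separates depends on the spiders picked, hence the product over
      \<open>v0\<close>; the differences take care of grid points with a repeated centre value. The
      degree is at most \<open>D2\<close>.\<close>
    define R where "R \<theta> = (\<Prod>v0<U. Q b z v0 (rel_point C \<theta>)) * (\<Prod>(j, j')\<in>{(j, j'). j < j' \<and> j' < n}. \<theta> j - \<theta> j')" for \<theta>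
    have "R \<theta>0 \<in> Z"
    proof (rule polyfun_zero_of_grid[of D2 R "{..<n}" "S z" \<theta>0])
      have "polyfun (card {..<U} * D) (\<lambda>\<theta>. \<Prod>v0<U. Q b z v0 (rel_point C \<theta>))"
      proof (rule polyfun_prod)
        fix v0 assume "v0 \<in> {..<U}"
        then have "polyfun D (Q b z v0)" using Q z(1) unfolding good_def by auto
        moreover have "polyfun 1 (\<lambda>\<theta>. rel_point C \<theta> w)" for w
          unfolding rel_point_def by (cases w) (auto intro: polyfun.const polyfun.var split: prod.splits)
        ultimately have "polyfun (D * 1) (\<lambda>\<theta>. Q b z v0 (\<lambda>w. rel_point C \<theta> w))" by (rule polyfun_compose)
        then show "polyfun D (\<lambda>\<theta>. Q b z v0 (rel_point C \<theta>))" by simp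
      qed
      moreover have "polyfun (card {(j, j'). j < j' \<and> j' < n} * 1)
          (\<lambda>\<theta> :: nat \<Rightarrow> 'a. \<Prod>e\<in>{(j, j'). j < j' \<and> j' < n}. \<theta> (fst e) - \<theta> (snd e))"
        by (rule polyfun_prod) (intro polyfun_diff polyfun.var, auto)
      then have "polyfun (n * n) (\<lambda>\<theta> :: nat \<Rightarrow> 'a. \<Prod>(j, j')\<in>{(j, j'). j < j' \<and> j' < n}. \<theta> j - \<theta> j')"
        using cards(2) by (auto simp: case_prod_beta intro: polyfun_mono)
      ultimately show "polyfun D2 R" unfolding R_def D2_def by (intro polyfun_mult) simp_all
      show "finite (S z)" "D2 < card (S z)" using z unfolding S_def by auto
      show "x = y" if "x \<in> S z" "y \<in> S z" "x - y \<in> Z" for x y using that SF reps_unique by blast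
      fix \<theta> assume \<theta>: "\<And>j. j \<in> {..<n} \<Longrightarrow> \<theta> j \<in> S z" "\<And>j. j \<notin> {..<n} \<Longrightarrow> \<theta> j = \<theta>0 j"
      show "R \<theta> \<in> Z"
      proof (cases "inj_on \<theta> {..<n}")
        case False
        then obtain j j' where j: "j < n" "j' < n" "j \<noteq> j'" "\<theta> j = \<theta> j'" unfolding inj_on_def by auto
        then have "(min j j', max j j') \<in> {(j, j'). j < j' \<and> j' < n}" by auto
        moreover have "\<theta> (min j j') - \<theta> (max j j') = 0" using j by (auto simp: min_def max_def)
        ultimately have "\<exists>e\<in>{(j, j'). j < j' \<and> j' < n}. (case e of (j, j') \<Rightarrow> \<theta> j - \<theta> j') = 0"
          by (intro bexI[of _ "(min j j', max j j')"]) auto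
        then have "(\<Prod>(j, j')\<in>{(j, j'). j < j' \<and> j' < n}. \<theta> j - \<theta> j') = 0"
          using fin(2) by (intro prod_zero)
        then show ?thesis unfolding R_def using zero by simp
      next
        case True
        have "\<exists>j'<t. \<theta> j = X (0, j', 2 * k) z" if "j < n" for j
          using \<theta>(1)[of j] that unfolding S_def by auto
        then obtain \<sigma> where \<sigma>: "\<And>j. j < n \<Longrightarrow> \<sigma> j < t" "\<And>j. j < n \<Longrightarrow> \<theta> j = X (0, \<sigma> j, 2 * k) z" by metis
        have \<sigma>_inj: "j = j'" if "j < n" "j' < n" "\<sigma> j = \<sigma> j'" for j j'
          using that \<sigma>(2) True by (metis inj_onD lessThan_iff)
        \<comment> \<open>The \<open>n\<close> spiders selected by \<open>\<sigma>\<close>, with the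
          same leaves. The default for \<open>j \<ge> n\<close> makes the centre coordinates agree
          with \<open>\<theta>\<close> as a whole function.\<close>
        define X' where "X' = (\<lambda>(i, j, m). if m = (0::nat) then X (i :: nat, 0, 0)
            else if j < n then X (i, \<sigma> j, m) else (\<lambda>_. \<theta> j))"
        define \<tau> where "\<tau> = (\<lambda>(i :: nat, j, m :: nat). (i, \<sigma> j, m))"
        have ends: "X' (M_end b k h) = X (M_end b k (\<tau> h))" "X' (N_end b k h) = X (N_end b k (\<tau> h))"
          and \<tau>H: "\<tau> h \<in> {..<s} \<times> {..<t} \<times> {..<2 * k}" if "h \<in> H" for h
          using that \<sigma>(1) unfolding H_def M_end_def N_end_def X'_def \<tau>_def spider_label_def
          by (auto split: prod.splits)
        have \<tau>_inj: "h = h'" if "h \<in> H" "h' \<in> H" "\<tau> h = \<tau> h'" for h h'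
          using that \<sigma>_inj unfolding H_def \<tau>_def by auto
        have inc': "incident Z a l c U E \<omega> C (X' (M_end b k h)) (X' (N_end b k h))" if "h \<in> H" for h
          using bspec[OF inc \<tau>H[OF that]] unfolding ends[OF that] .
        \<comment> \<open>By \<open>incident_determines\<close>, edges that differ at all differ in
          a coordinate visible to the linear forms.\<close>
        have dist: "(\<exists>i. c \<le> i \<and> i < a \<and> X' (M_end b k h) i - X' (M_end b k h') i \<notin> Z)
            \<or> (\<exists>i<l. X' (N_end b k h) i - X' (N_end b k h') i \<notin> Z)"
          if hh: "h \<in> H" "h' \<in> H" "h \<noteq> h'" for h h'
        proof (rule ccontr)
          assume con: "\<not> ?thesis"
          then have "X' (M_end b k h) i - X' (M_end b k h') i \<in> Z" if "i < a" for i
            using incident_determines[OF inc'[OF hh(1)] inc'[OF hh(2)] _ _ that] by blast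
          moreover have "\<tau> h \<noteq> \<tau> h'" using \<tau>_inj hh by blast
          then have "(\<exists>z<a. X' (M_end b k h) z - X' (M_end b k h') z \<notin> Z) \<or>
              (\<exists>z<l. X' (N_end b k h) z - X' (N_end b k h') z \<notin> Z)"
            using bspec[OF bspec[OF edist \<tau>H[OF hh(1)]] \<tau>H[OF hh(2)]]
            unfolding ends[OF hh(1)] ends[OF hh(2)] by (rule mp[rotated])
          ultimately show False using con by blast
        qed
        have "\<exists>v<U. \<forall>h\<in>H. \<forall>h'\<in>H. lin_form a l c (\<omega> v) (X' (M_end b k h)) (X' (N_end b k h))
            - lin_form a l c (\<omega> v) (X' (M_end b k h')) (X' (N_end b k h')) \<in> Z \<longrightarrow> h = h'"
          by (rule separating_form[OF H(1) \<omega> _ dist]) (simp_all add: H(2) U)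
        then obtain v0 where v0: "v0 < U" "\<forall>h\<in>H. \<forall>h'\<in>H. lin_form a l c (\<omega> v0) (X' (M_end b k h)) (X' (N_end b k h))
            - lin_form a l c (\<omega> v0) (X' (M_end b k h')) (X' (N_end b k h')) \<in> Z \<longrightarrow> h = h'" by blast
        have "Q b z v0 (rel_point C (\<lambda>j. X' (0, j, 2 * k) z)) \<in> Z"
          using Q[OF z(1) v0(1)] inc' v0(2) unfolding good_def by blast
        also have "(\<lambda>j. X' (0, j, 2 * k) z) = \<theta>"
          unfolding X'_def using \<sigma>(2) pos by auto
        finally have "(\<Prod>v0<U. Q b z v0 (rel_point C \<theta>)) \<in> Z"
          using v0(1) by (auto simp: prod_mem_iff)
        then show ?thesis unfolding R_def using mult' by blast
      qed
    qed auto
    then have "(\<Prod>v0<U. Q b z v0 (rel_point C \<theta>0)) \<in> Z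
        \<or> (\<Prod>(j, j')\<in>{(j, j'). j < j' \<and> j' < n}. \<theta>0 j - \<theta>0 j') \<in> Z"
      unfolding R_def by (rule prime)
    then show False using vQ[OF z(1)] v\<theta> fin(2) by (auto simp: prod_mem_iff)
  qed
qed

end

section \<open>The graph\<close>

definition spider_vertex :: "nat \<Rightarrow> nat \<Rightarrow> nat \<times> nat \<times> nat \<Rightarrow> nat + nat set \<times> nat" where
  "spider_vertex k s = (\<lambda>(i, j, m). if m = 0 then Inl i else if m = 2 * k then Inl (s + j) else Inr ({i, s + j}, m))"

text \<open>\<open>{i, s + j}\<close> has minimum \<open>i\<close>, so the subdivided path runs from
  the leaf \<open>i\<close> to the centre \<open>s + j\<close>.\<close>

lemma spider_vertex_label:
  assumes "i < s"
  shows "spider_vertex k s (spider_label k i j m) = subdiv_path (2 * k) {i, s + j} m"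
  using assms unfolding spider_vertex_def spider_label_def subdiv_path_def by auto

lemma subdivision_edge:
  assumes "i < s" "j < t" "m < 2 * k"
  shows "{subdiv_path (2 * k) {i, s + j} m, subdiv_path (2 * k) {i, s + j} (Suc m)}
    \<in> edges (subdivision (2 * k) (complete_bipartite s t))"
proof -
  have "\<exists>i' j'. {i, s + j} = {i', j'} \<and> i' < s \<and> s \<le> j' \<and> j' < s + t"
    using assms by (intro exI[of _ i] exI[of _ "s + j"]) simp
  then have "{i, s + j} \<in> edges (complete_bipartite s t)"
    unfolding complete_bipartite_def by simp
  then show ?thesis unfolding subdivision_def snd_conv mem_Collect_eq
    by (intro exI[of _ "{i, s + j}"] exI[of _ m] conjI refl assms(3))
qed

lemma subdiv_path_mem_verts:
  assumes "i < s" "j < t" "m \<le> 2 * k"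
  shows "subdiv_path (2 * k) {i, s + j} m \<in> verts (subdivision (2 * k) (complete_bipartite s t))"
proof -
  have "\<exists>i' j'. {i, s + j} = {i', j'} \<and> i' < s \<and> s \<le> j' \<and> j' < s + t"
    using assms by (intro exI[of _ i] exI[of _ "s + j"]) simp
  then have "{i, s + j} \<in> edges (complete_bipartite s t)"
    unfolding complete_bipartite_def by simp
  moreover have "i \<in> verts (complete_bipartite s t)" "s + j \<in> verts (complete_bipartite s t)"
    unfolding complete_bipartite_def using assms by auto
  ultimately show ?thesis
    unfolding subdivision_def subdiv_path_def using assms by auto
qed

text \<open>In a path of even length an odd position is internal, so its vertex names the path; the
  even end then tells the two edges at that vertex apart.\<close>

lemma subdiv_path_ends_eq:
  fixes i i' j j' s :: nat
  assumes "i < s" "i' < s" "m < 2 * k" "m' < 2 * k"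
    and ev: "subdiv_path (2 * k) {i, s + j} (even_end m) = subdiv_path (2 * k) {i', s + j'} (even_end m')"
    and od: "subdiv_path (2 * k) {i, s + j} (odd_end m) = subdiv_path (2 * k) {i', s + j'} (odd_end m')"
  shows "(i, j, m) = (i', j', m')"
proof -
  have o: "odd_end m \<noteq> 0" "odd_end m \<noteq> 2 * k" "odd_end m' \<noteq> 0" "odd_end m' \<noteq> 2 * k"
    using assms(3,4) unfolding odd_end_def by (auto split: if_splits) presburger+
  then have eq: "{i, s + j} = {i', s + j'}" "odd_end m = odd_end m'"
    using od unfolding subdiv_path_def by auto
  then have ij: "i = i'" "j = j'" using assms(1,2) by (auto simp: doubleton_eq_iff)
  have e: "even_end m \<le> 2 * k" "even_end m' \<le> 2 * k"
    using assms(3,4) unfolding even_end_def by (auto elim!: oddE)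
  have "even_end m = even_end m'"
    using ev e assms(1) unfolding ij subdiv_path_def by (auto split: if_splits)
  then have "m = m'" using eq(2) unfolding even_end_def odd_end_def by (auto split: if_splits)
  then show ?thesis using ij by simp
qed

context residue_field
begin

text \<open>The coordinates of \<open>x\<close> from \<open>c\<close> on and all of \<open>y\<close>
  are free; the first \<open>c\<close> coordinates are then solved for.\<close>

lemma card_incident_ge:
  assumes ca: "c \<le> a"
  shows "card F ^ (a - c + l) \<le> card {(x, y) \<in> PiE {..<a} (\<lambda>_. F) \<times> PiE {..<l} (\<lambda>_. F). incident Z a l c U E \<omega> C x y}"
proof -
  define A where "A = PiE {c..<a} (\<lambda>_. F) \<times> PiE {..<l} (\<lambda>_. F)"
  define g where "g = (\<lambda>(x, y). (\<lambda>i. if i < c then rep (edge_fun a l c U E \<omega> (C i) x y) else x i :: 'a, y :: nat \<Rightarrow> 'a))"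
  have "card A = card F ^ (a - c + l)"
    unfolding A_def by (simp add: card_cartesian_product card_PiE power_add)
  moreover have "inj_on g A"
  proof (rule inj_onI)
    fix p p' assume p: "p \<in> A" "p' \<in> A" "g p = g p'"
    obtain x y x' y' where xy: "p = (x, y)" "p' = (x', y')" by (cases p, cases p') auto
    have "y = y'" using p(3) unfolding xy g_def by simp
    moreover have "x i = x' i" if "c \<le> i" for i
      using arg_cong[OF p(3), of "\<lambda>e. fst e i"] that unfolding xy g_def by simp
    then have "x = x'" using p(1,2) unfolding xy A_def by (intro PiE_ext[of x "{c..<a}" "\<lambda>_. F" x']) auto
    ultimately show "p = p'" unfolding xy by simp
  qed
  moreover have "g ` A \<subseteq> {(x, y) \<in> PiE {..<a} (\<lambda>_. F) \<times> PiE {..<l} (\<lambda>_. F). incident Z a l c U E \<omega> C x y}"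
  proof
    fix w assume "w \<in> g ` A"
    then obtain x y where xy: "x \<in> PiE {c..<a} (\<lambda>_. F)" "y \<in> PiE {..<l} (\<lambda>_. F)" "w = g (x, y)"
      unfolding A_def by auto
    define x' where "x' i = (if i < c then rep (edge_fun a l c U E \<omega> (C i) x y) else x i)" for i
    have "w = (x', y)" unfolding xy(3) g_def x'_def by simp
    moreover have "x' \<in> PiE {..<a} (\<lambda>_. F)"
      using xy(1) ca rep(1) unfolding x'_def by (auto simp: PiE_iff extensional_def)
    moreover have "edge_fun a l c U E \<omega> (C i) x' y = edge_fun a l c U E \<omega> (C i) x y" for i
      unfolding edge_fun_def
      by (intro sum.cong refl arg_cong2[where f = "(*)"] arg_cong2[where f = power] lin_form_cong) (auto simp: x'_def)
    then have "incident Z a l c U E \<omega> C x' y"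
      unfolding incident_def using rep(3) by (simp add: x'_def)
    ultimately show "w \<in> {(x, y) \<in> PiE {..<a} (\<lambda>_. F) \<times> PiE {..<l} (\<lambda>_. F). incident Z a l c U E \<omega> C x y}"
      using xy(2) by simp
  qed
  moreover have "finite {(x, y) \<in> PiE {..<a} (\<lambda>_. F) \<times> PiE {..<l} (\<lambda>_. F). incident Z a l c U E \<omega> C x y}"
    by (rule finite_subset[of _ "PiE {..<a} (\<lambda>_. F) \<times> PiE {..<l} (\<lambda>_. F)"])
      (auto intro!: finite_PiE finite_reps)
  ultimately show ?thesis using card_mono[of _ "g ` A"] card_image[of g A] by simp
qed

text \<open>Vertices are numbered by naturals, \<open>M\<close> before \<open>N\<close>. A copy of
  the subdivision alternates between the parts along every leg, so it would yield a configuration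
  excluded by \<open>C\<close>.\<close>

lemma incidence_graph:
  assumes ca: "c \<le> a" and pos: "k \<ge> 1" "s \<ge> 1"
    and C: "\<And>b X. \<not> spider_configuration Z F a l (incident Z a l c U E \<omega> C) k s t b X"
  shows "\<exists>(G :: nat ugraph) M N. bipartite_with_parts G M N \<and> card M = card F ^ a \<and> card N = card F ^ l
    \<and> is_free (subdivision (2 * k) (complete_bipartite s t)) G \<and> card F ^ (a - c + l) \<le> card (edges G)"
proof -
  define MV where "MV = PiE {..<a} (\<lambda>_. F)"
  define NV where "NV = PiE {..<l} (\<lambda>_. F)"
  have fin: "finite MV" "finite NV" unfolding MV_def NV_def by (auto intro!: finite_PiE finite_reps)
  have cards: "card MV = card F ^ a" "card NV = card F ^ l"
    unfolding MV_def NV_def by (simp_all add: card_PiE)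
  define A where "A = card F ^ a"
  define B where "B = card F ^ l"
  obtain \<mu> where \<mu>: "bij_betw \<mu> {..<A} MV"
    using ex_bij_betw_nat_finite[OF fin(1)] cards unfolding A_def by (auto simp: atLeast0LessThan)
  obtain \<nu>0 where \<nu>0: "bij_betw \<nu>0 {..<B} NV"
    using ex_bij_betw_nat_finite[OF fin(2)] cards unfolding B_def by (auto simp: atLeast0LessThan)
  define \<nu> where "\<nu> w = \<nu>0 (w - A)" for w
  define M where "M = {..<A}"
  define N where "N = {A..<A + B}"
  have "bij_betw (\<lambda>w. w - A) N {..<B}"
    unfolding N_def by (rule bij_betwI[where g = "\<lambda>w. w + A"]) auto
  then have \<nu>: "bij_betw \<nu> N NV" using bij_betw_trans[OF _ \<nu>0] unfolding \<nu>_def comp_def by blast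
  note \<mu> = \<mu>[folded M_def]
  have MN: "M \<inter> N = {}" unfolding M_def N_def by auto
  define adj where "adj x y \<longleftrightarrow> incident Z a l c U E \<omega> C (\<mu> x) (\<nu> y)" for x y
  define G :: "nat ugraph" where "G = (M \<union> N, {{x, y} | x y. x \<in> M \<and> y \<in> N \<and> adj x y})"
  have bip: "bipartite_with_parts G M N"
    unfolding bipartite_with_parts_def finite_simple_graph_def G_def
  proof (intro conjI ballI)
    show "finite (verts (M \<union> N, {{x, y} | x y. x \<in> M \<and> y \<in> N \<and> adj x y}))" unfolding M_def N_def by simp
    fix e assume "e \<in> edges (M \<union> N, {{x, y} | x y. x \<in> M \<and> y \<in> N \<and> adj x y})"
    then obtain x y where e: "e = {x, y}" "x \<in> M" "y \<in> N" by auto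
    then have "x \<noteq> y" using MN by blast
    then show "e \<subseteq> verts (M \<union> N, {{x, y} | x y. x \<in> M \<and> y \<in> N \<and> adj x y})" "card e = 2"
      "\<exists>x\<in>M. \<exists>y\<in>N. e = {x, y}" using e by auto
  qed (use MN in auto)
  have edges_card: "card F ^ (a - c + l) \<le> card (edges G)"
  proof -
    define S where "S = {(x, y) \<in> M \<times> N. adj x y}"
    have "inj_on (\<lambda>(x, y). {x, y}) S"
      using MN unfolding S_def by (auto intro!: inj_onI simp: doubleton_eq_iff)
    moreover have "edges G = (\<lambda>(x, y). {x, y}) ` S" unfolding G_def S_def by auto
    ultimately have 1: "card (edges G) = card S" by (simp add: card_image)
    have "inj_on (map_prod \<mu> \<nu>) (M \<times> N)"
      using \<mu> \<nu> by (intro map_prod_inj_on) (auto simp: bij_betw_def)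
    then have "inj_on (map_prod \<mu> \<nu>) S" by (rule inj_on_subset) (auto simp: S_def)
    moreover have "map_prod \<mu> \<nu> ` S = {(x, y) \<in> MV \<times> NV. incident Z a l c U E \<omega> C x y}"
    proof (intro equalityI subsetI)
      fix w assume "w \<in> {(x, y) \<in> MV \<times> NV. incident Z a l c U E \<omega> C x y}"
      then obtain x y where w: "w = (x, y)" "x \<in> MV" "y \<in> NV" "incident Z a l c U E \<omega> C x y" by auto
      then obtain x' y' where "x' \<in> M" "x = \<mu> x'" "y' \<in> N" "y = \<nu> y'"
        using \<mu> \<nu> unfolding bij_betw_def by blast
      then show "w \<in> map_prod \<mu> \<nu> ` S" using w unfolding S_def adj_def by force
    next
      fix w assume "w \<in> map_prod \<mu> \<nu> ` S"
      then show "w \<in> {(x, y) \<in> MV \<times> NV. incident Z a l c U E \<omega> C x y}"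
        using bij_betwE[OF \<mu>] bij_betwE[OF \<nu>] unfolding S_def adj_def by auto
    qed
    ultimately have "card S = card {(x, y) \<in> MV \<times> NV. incident Z a l c U E \<omega> C x y}"
      by (metis card_image)
    then show ?thesis using card_incident_ge[OF ca] 1 unfolding MV_def NV_def by simp
  qed
  have "is_free (subdivision (2 * k) (complete_bipartite s t)) G"
    unfolding is_free_def
  proof
    assume "contains_copy G (subdivision (2 * k) (complete_bipartite s t))"
    then obtain f where f: "inj_on f (verts (subdivision (2 * k) (complete_bipartite s t)))"
      and fe: "\<And>e. e \<in> edges (subdivision (2 * k) (complete_bipartite s t)) \<Longrightarrow> f ` e \<in> edges G"
      and fv: "f ` verts (subdivision (2 * k) (complete_bipartite s t)) \<subseteq> verts G"
      unfolding contains_copy_def by blast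
    define P where "P i j m = f (subdiv_path (2 * k) {i, s + j} m)" for i j m
    have edge: "(P i j m \<in> M \<and> P i j (Suc m) \<in> N \<and> adj (P i j m) (P i j (Suc m))) \<or>
        (P i j m \<in> N \<and> P i j (Suc m) \<in> M \<and> adj (P i j (Suc m)) (P i j m))"
      if ijm: "i < s" "j < t" "m < 2 * k" for i j m
    proof -
      have "{P i j m, P i j (Suc m)} \<in> edges G"
        using fe[OF subdivision_edge[OF ijm]] unfolding P_def by simp
      then obtain x y where "{P i j m, P i j (Suc m)} = {x, y}" "x \<in> M" "y \<in> N" "adj x y"
        unfolding G_def by auto
      then show ?thesis by (auto simp: doubleton_eq_iff)
    qed
    have notboth: "w \<notin> N" if "w \<in> M" for w using that MN by blast
    have par: "if even m then P i j m \<in> M \<longleftrightarrow> P i j 0 \<in> M else P i j m \<in> M \<longleftrightarrow> P i j 0 \<notin> M"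
      if ij: "i < s" "j < t" "m \<le> 2 * k" for i j m
      using ij(3)
    proof (induction m)
      case (Suc m)
      then show ?case using edge[OF ij(1,2), of m] notboth by (auto split: if_splits)
    qed simp
    \<comment> \<open>All centres are joined to leaf 0, and every leaf to the centres, by paths of
      even length, so one flag records the side of them all.\<close>
    define b where "b \<longleftrightarrow> f (Inl 0) \<in> M"
    have P0: "P i j 0 = f (Inl i)" if "i < s" for i j unfolding P_def subdiv_path_def using that by simp
    have P2k: "P i j (2 * k) = f (Inl (s + j))" if "i < s" for i j
      unfolding P_def subdiv_path_def using that pos by simp
    have cb: "f (Inl (s + j)) \<in> M \<longleftrightarrow> b" if "j < t" for j
      using par[of 0 j "2 * k"] that pos P0[of 0 j] P2k[of 0 j] unfolding b_def by simp
    have rb: "P i j 0 \<in> M \<longleftrightarrow> b" if "i < s" "j < t" for i j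
      using par[OF that, of "2 * k"] cb[OF that(2)] P2k[OF that(1), of j] by simp
    have side: "P i j m \<in> M \<longleftrightarrow> (even m \<longleftrightarrow> b)" if "i < s" "j < t" "m \<le> 2 * k" for i j m
      using par[OF that] rb[OF that(1,2)] by (auto split: if_splits)
    define vec where "vec w = (if w \<in> M then \<mu> w else \<nu> w)" for w
    define X where "X p = vec (f (spider_vertex k s p))" for p
    have XP: "X (spider_label k i j m) = vec (P i j m)" if "i < s" for i j m
      unfolding X_def P_def spider_vertex_label[OF that] ..
    have Xc: "X (0, j, 2 * k) = vec (f (Inl (s + j)))" for j
      unfolding X_def spider_vertex_def using pos by simp
    have ends: "P i j (if b then even_end m else odd_end m) \<in> M \<and> P i j (if b then odd_end m else even_end m) \<in> N
        \<and> adj (P i j (if b then even_end m else odd_end m)) (P i j (if b then odd_end m else even_end m))"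
      if ijm: "i < s" "j < t" "m < 2 * k" for i j m
      using edge[OF ijm] side[OF ijm(1,2), of m] notboth ijm(3) unfolding even_end_def odd_end_def
      by (cases b; cases "even m") auto
    have vecM: "vec w = \<mu> w" if "w \<in> M" for w unfolding vec_def using that by simp
    have vecN: "vec w = \<nu> w" if "w \<in> N" for w unfolding vec_def using that notboth by auto
    have diffM: "\<exists>z<a. \<mu> w z \<noteq> \<mu> w' z" if "w \<in> M" "w' \<in> M" "w \<noteq> w'" for w w'
    proof (rule ccontr)
      assume "\<not> ?thesis"
      then have "\<mu> w = \<mu> w'" using bij_betwE[OF \<mu>] that(1,2) unfolding MV_def
        by (intro PiE_ext[of _ "{..<a}" "\<lambda>_. F"]) auto
      then show False using \<mu> that unfolding bij_betw_def inj_on_def by blast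
    qed
    have diffN: "\<exists>z<l. \<nu> w z \<noteq> \<nu> w' z" if "w \<in> N" "w' \<in> N" "w \<noteq> w'" for w w'
    proof (rule ccontr)
      assume "\<not> ?thesis"
      then have "\<nu> w = \<nu> w'" using bij_betwE[OF \<nu>] that(1,2) unfolding NV_def
        by (intro PiE_ext[of _ "{..<l}" "\<lambda>_. F"]) auto
      then show False using \<nu> that unfolding bij_betw_def inj_on_def by blast
    qed
    have \<mu>F: "\<mu> w z \<in> F" if "w \<in> M" "z < a" for w z using bij_betwE[OF \<mu>] that unfolding MV_def by auto
    have \<nu>F: "\<nu> w z \<in> F" if "w \<in> N" "z < l" for w z using bij_betwE[OF \<nu>] that unfolding NV_def by auto
    have P_verts: "subdiv_path (2 * k) {i, s + j} m \<in> verts (subdivision (2 * k) (complete_bipartite s t))"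
      if "i < s" "j < t" "m \<le> 2 * k" for i j m using subdiv_path_mem_verts[OF that] .
    have centre_verts: "Inl (s + j) \<in> verts (subdivision (2 * k) (complete_bipartite s t))" if "j < t" for j
      using that unfolding subdivision_def complete_bipartite_def by auto
    have centre_side: "f (Inl (s + j)) \<in> (if b then M else N)" if "j < t" for j
      using cb[OF that] fv centre_verts[OF that] unfolding G_def by auto
    have le: "even_end m \<le> 2 * k" "odd_end m \<le> 2 * k" if "m < 2 * k" for m
      using that unfolding even_end_def odd_end_def by (auto elim!: oddE)
    have "spider_configuration Z F a l (incident Z a l c U E \<omega> C) k s t b X"
      unfolding spider_configuration_def
    proof (intro conjI allI ballI impI)
      fix j z assume "j < t" "z < (if b then a else l)"
      then show "X (0, j, 2 * k) z \<in> F"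
        using centre_side[of j] \<mu>F \<nu>F vecM vecN unfolding Xc by (auto split: if_splits)
    next
      fix j j' assume j: "j < t" "j' < t" "j \<noteq> j'"
      then have "f (Inl (s + j)) \<noteq> f (Inl (s + j'))"
        using inj_onD[OF f _ centre_verts[OF j(1)] centre_verts[OF j(2)]] by auto
      then show "\<exists>z<if b then a else l. X (0, j, 2 * k) z \<noteq> X (0, j', 2 * k) z"
        using centre_side[OF j(1)] centre_side[OF j(2)] diffM diffN unfolding Xc
        by (cases b) (simp_all add: vecM vecN)
    next
      fix h assume "h \<in> {..<s} \<times> {..<t} \<times> {..<2 * k}"
      then obtain i j m where h: "h = (i, j, m)" "i < s" "j < t" "m < 2 * k" by auto
      show "incident Z a l c U E \<omega> C (X (M_end b k h)) (X (N_end b k h))"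
        using ends[OF h(2-4)] unfolding h(1) M_end_def N_end_def adj_def by (simp add: XP[OF h(2)] vecM vecN)
    next
      fix h h' assume hm: "h \<in> {..<s} \<times> {..<t} \<times> {..<2 * k}" and hm': "h' \<in> {..<s} \<times> {..<t} \<times> {..<2 * k}"
        and ne: "h \<noteq> h'"
      from hm obtain i j m where h: "h = (i, j, m)" "i < s" "j < t" "m < 2 * k" by auto
      from hm' obtain i' j' m' where h': "h' = (i', j', m')" "i' < s" "j' < t" "m' < 2 * k" by auto
      define x y x' y' where "x = P i j (if b then even_end m else odd_end m)"
        and "y = P i j (if b then odd_end m else even_end m)"
        and "x' = P i' j' (if b then even_end m' else odd_end m')"
        and "y' = P i' j' (if b then odd_end m' else even_end m')"
      note xy = x_def y_def x'_def y'_def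
      have mem: "x \<in> M" "y \<in> N" "x' \<in> M" "y' \<in> N"
        using ends[OF h(2-4)] ends[OF h'(2-4)] unfolding xy by blast+
      have XE: "X (M_end b k h) = \<mu> x" "X (N_end b k h) = \<nu> y" "X (M_end b k h') = \<mu> x'" "X (N_end b k h') = \<nu> y'"
        using mem vecM vecN unfolding h(1) h'(1) M_end_def N_end_def xy by (simp_all add: XP[OF h(2)] XP[OF h'(2)])
      \<comment> \<open>Injectivity of \<open>f\<close> moves the question to the subdivision, where
        the two ends determine the edge.\<close>
      have "x \<noteq> x' \<or> y \<noteq> y'"
      proof (rule ccontr)
        assume "\<not> ?thesis"
        then have "P i j (even_end m) = P i' j' (even_end m')" "P i j (odd_end m) = P i' j' (odd_end m')"
          unfolding xy by (cases b; simp)+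
        then have "(i, j, m) = (i', j', m')"
          unfolding P_def using P_verts h h' le
          by (intro subdiv_path_ends_eq[of i s i' m k m' j j'] inj_onD[OF f]) auto
        then show False using ne h(1) h'(1) by simp
      qed
      then have "(\<exists>z<a. \<mu> x z \<noteq> \<mu> x' z) \<or> (\<exists>z<l. \<nu> y z \<noteq> \<nu> y' z)"
        using diffM diffN mem by blast
      then show "(\<exists>z<a. X (M_end b k h) z - X (M_end b k h') z \<notin> Z) \<or>
          (\<exists>z<l. X (N_end b k h) z - X (N_end b k h') z \<notin> Z)"
        unfolding XE using \<mu>F[OF mem(1)] \<mu>F[OF mem(3)] \<nu>F[OF mem(2)] \<nu>F[OF mem(4)] reps_unique by metis
    qed
    then show False using C by blast
  qed
  moreover have "card M = card F ^ a" "card N = card F ^ l" unfolding M_def N_def A_def B_def by simp_all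
  ultimately show ?thesis using bip edges_card
    by (intro exI[of _ G] exI[of _ M] exI[of _ N] conjI)
qed

end

section \<open>Dimension count and choice of the constants\<close>

text \<open>The value of \<open>c\<close> makes \<open>a - c + l\<close> the exponent of
  \<open>q\<close> in the required number of edges. Then \<open>bal\<close> amounts to
  \<open>c \<le> a\<close>, the count with leaves in \<open>M\<close> is an equality, and the other
  count follows from \<open>A \<le> L\<close>.\<close>

lemma spider_dimension_counts:
  fixes k s A L :: nat
  assumes k: "k \<ge> 1" and s: "s \<ge> 1" and AL: "A \<le> L" and bal: "k * s * L \<le> (k * s + s - 1) * A"
  defines "a \<equiv> 2 * k * s * A" and "l \<equiv> 2 * k * s * L" and "c \<equiv> k * s * L + (k * s - s + 1) * A"
  shows "c \<le> a" "a \<le> l"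
    "a * (1 + s * (k - 1)) + l * (s * k) \<le> 2 * k * s * c"
    "l * (1 + s * (k - 1)) + a * (s * k) \<le> 2 * k * s * c"
    "a - c + l + A = k * s * L + k * s * A + s * A"
proof -
  obtain k' where k': "k = Suc k'" using k by (cases k) auto
  obtain s' where s': "s = Suc s'" using s by (cases s) auto
  have c: "c = k * s * L + (k' * s + 1) * A" unfolding c_def k' by simp
  have "k * s + s - 1 = k' * s + 2 * s' + 1" unfolding k' s' by simp
  then have bal': "k * s * L \<le> (k' * s + 2 * s' + 1) * A" using bal by simp
  have a: "a = (k' * s + 1) * A + (k' * s + 2 * s' + 1) * A"
    unfolding a_def k' s' by (simp add: algebra_simps)
  show ca: "c \<le> a" unfolding c a using bal' by simp
  show "a \<le> l" unfolding a_def l_def using AL by simp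
  have "a * (1 + s * (k - 1)) + l * (s * k) = 2 * k * s * c"
    unfolding c a_def l_def k' by (simp add: algebra_simps)
  then show "a * (1 + s * (k - 1)) + l * (s * k) \<le> 2 * k * s * c" by simp
  have "L * (1 + s * k') + A * (s * k) \<le> c"
  proof -
    have "s' * A \<le> s' * L" using AL by simp
    then show ?thesis unfolding c k' s' by (simp add: algebra_simps)
  qed
  then have "2 * k * s * (L * (1 + s * k') + A * (s * k)) \<le> 2 * k * s * c" by (rule mult_left_mono) simp
  then show "l * (1 + s * (k - 1)) + a * (s * k) \<le> 2 * k * s * c"
    unfolding a_def l_def k' by (simp add: algebra_simps)
  have "a - c + l + A + c = k * s * L + k * s * A + s * A + c"
    using ca unfolding c a_def l_def k' by (simp add: algebra_simps)
  then show "a - c + l + A = k * s * L + k * s * A + s * A" by simp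
qed

theorem theorem5p10:
  fixes k s l :: nat and \<alpha> :: real
  assumes "k \<ge> 1" and "s \<ge> 1"
    and "\<alpha> \<in> \<rat>"
    and "\<alpha> \<in> {real k * real s / (real k * real s + real s - 1)..1}"
    and "l = (LEAST n::nat. n > 0 \<and> real n / (2 * real k * real s) \<in> \<int>
                \<and> \<alpha> * real n / (2 * real k * real s) \<in> \<int>)"
  shows "\<exists>t0 q0 :: nat. \<forall>t\<ge>t0. \<forall>q\<ge>q0. primepow q \<longrightarrow>
    (\<exists>(G :: nat ugraph) M N.
        bipartite_with_parts G M N \<and>
        real (card M) = real q powr (\<alpha> * real l) \<and>
        card N = q ^ l \<and>
        is_free (subdivision (2 * k) (complete_bipartite s t)) G \<and>
        real (card (edges G)) \<ge>
          1 / 2 * real (card M) powr (1 / 2 + 1 / (2 * real k) - 1 / (2 * real k * real s))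
                * real (card N) powr (1 / 2))"
proof -
  define P where "P n \<longleftrightarrow> n > 0 \<and> real n / (2 * real k * real s) \<in> \<int>
    \<and> \<alpha> * real n / (2 * real k * real s) \<in> \<int>" for n :: nat
  have ks: "real k \<ge> 1" "real s \<ge> 1" using assms(1,2) by auto
  have ks0: "real k * real s > 0" using ks by (intro mult_pos_pos) auto
  obtain x y where xy: "y > 0" "\<alpha> = of_int x / of_int y"
    using assms(3) by (elim Rats_cases') auto
  \<comment> \<open>Clearing the denominator of \<open>\<alpha>\<close> gives a number with the
    property \<open>P\<close>, so the minimum \<open>l\<close> has it too.\<close>
  have "P (nat y * (2 * k * s))"
  proof -
    have "real (nat y * (2 * k * s)) / (2 * real k * real s) = of_int y"
      using xy(1) assms(1,2) by simp
    moreover have "\<alpha> * real (nat y * (2 * k * s)) / (2 * real k * real s) = of_int x"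
      using xy assms(1,2) by (simp add: field_simps)
    moreover have "nat y * (2 * k * s) > 0" using xy(1) assms(1,2) by simp
    ultimately show ?thesis unfolding P_def by (simp only: Ints_of_int simp_thms)
  qed
  then have "P l" using LeastI[of P] assms(5) unfolding P_def by blast
  then obtain Li Ai where l0: "l > 0" and Li: "real l / (2 * real k * real s) = of_int Li"
    and Ai: "\<alpha> * real l / (2 * real k * real s) = of_int Ai" unfolding P_def by (auto elim!: Ints_cases)
  have den: "real k * real s + real s - 1 > 0" using ks0 ks by linarith
  have \<alpha>: "real k * real s \<le> \<alpha> * (real k * real s + real s - 1)" "\<alpha> \<le> 1"
    using assms(4) den by (auto simp: pos_divide_le_eq)
  have \<alpha>0: "\<alpha> \<ge> 0" using assms(4) den ks0 by (auto intro: order_trans[rotated])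
  define L where "L = nat Li"
  define A where "A = nat Ai"
  have "real_of_int Li \<ge> 0" "real_of_int Ai \<ge> 0"
    using \<alpha>0 ks0 unfolding Li[symmetric] Ai[symmetric] by auto
  then have "real L = of_int Li" "real A = of_int Ai" unfolding L_def A_def by auto
  then have L: "real l = 2 * real k * real s * real L" and \<alpha>l: "\<alpha> * real l = 2 * real k * real s * real A"
    using Li Ai assms(1,2) by (auto simp: field_simps)
  have "2 * real k * real s * real A = 2 * real k * real s * (\<alpha> * real L)"
    using \<alpha>l unfolding L by (simp only: mult_ac)
  then have A: "real A = \<alpha> * real L" using assms(1,2) by simp
  have "real l = real (2 * k * s * L)" using L by simp
  then have l: "l = 2 * k * s * L" by (simp only: of_nat_eq_iff)
  have AL: "A \<le> L"
    using A \<alpha>(2) mult_right_mono[of \<alpha> 1 "real L"] by simp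
  have "real k * real s * real L \<le> (real k * real s + real s - 1) * real A"
    using mult_right_mono[OF \<alpha>(1), of "real L"] unfolding A by (simp add: algebra_simps)
  moreover have "real (k * s + s - 1) = real k * real s + real s - 1"
    using assms(2) by (simp add: of_nat_diff)
  ultimately have "real (k * s * L) \<le> real ((k * s + s - 1) * A)" by (simp del: of_nat_diff)
  then have bal: "k * s * L \<le> (k * s + s - 1) * A" by (simp only: of_nat_le_iff)
  define a where "a = 2 * k * s * A"
  define c where "c = k * s * L + (k * s - s + 1) * A"
  note dims = spider_dimension_counts[OF assms(1,2) AL bal, folded a_def l c_def]
  define n where "n = l * s + 2"
  define E where "E = s * (n * (2 * k))"
  define U where "U = E * E * (a + l) + 1"
  define r where "r = c * U * E + n - 1"
  define D where "D = Suc r * (dependence_base r (interpolation_degree E) - 1)"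
  define T where "T = (U * D + n * n) ^ l"
  \<comment> \<open>The sum of all lower bounds on the field size; the summand \<open>U\<close>
    secures that many distinct nodes \<open>\<omega> v\<close>.\<close>
  define q0 where "q0 = dependence_base r (interpolation_degree E) ^ Suc r + D * interpolation_degree E + (2 * l * U * D + n * n) + U + 1"
  show ?thesis
  proof (rule exI[of _ "Suc T"], rule exI[of _ q0], intro allI impI)
    fix t q assume t: "Suc T \<le> t" and q: "q0 \<le> q" "primepow q"
    obtain J F :: "int poly set" where JF: "residue_field J F" "card F = q"
      using residue_field_exists[OF q(2)] .
    interpret residue_field J F by (rule JF(1))
    obtain \<omega> where \<omega>: "bij_betw \<omega> {..<q} F"
      using ex_bij_betw_nat_finite[OF finite_reps] JF(2) by (auto simp: atLeast0LessThan)
    have \<omega>_sep: "v = v'" if v: "v < U" "v' < U" "\<omega> v - \<omega> v' \<in> J" for v v'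
    proof -
      have "v < q" "v' < q" using v q(1) unfolding q0_def by linarith+
      then show ?thesis using \<omega> reps_unique v(3) unfolding bij_betw_def inj_on_def by blast
    qed
    have q': "card F \<ge> dependence_base r (interpolation_degree E) ^ Suc r" "card F > D * interpolation_degree E"
      "card F > 2 * l * U * D + n * n"
      using q(1) JF(2) unfolding q0_def by linarith+
    from exists_coefficients[OF assms(1,2) dims(1-4) n_def E_def U_def \<omega>_sep r_def D_def q' T_def]
    obtain C where C: "\<And>b X t. T < t \<Longrightarrow> \<not> spider_configuration J F a l (incident J a l c U E \<omega> C) k s t b X"
      by blast
    have "T < t" using t by simp
    from incidence_graph[OF dims(1) assms(1,2) C[OF this]]
    obtain G :: "nat ugraph" and M N where G: "bipartite_with_parts G M N"
      "is_free (subdivision (2 * k) (complete_bipartite s t)) G"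
      and cM: "card M = q ^ a" and cN: "card N = q ^ l" and e: "q ^ (a - c + l) \<le> card (edges G)"
      unfolding JF(2) by blast
    have q0: "real q > 0" using q(1) unfolding q0_def by simp
    have ra: "real a = \<alpha> * real l" unfolding a_def \<alpha>l by simp
    have M: "real (card M) = real q powr (\<alpha> * real l)"
      unfolding cM ra[symmetric] using powr_realpow[OF q0] by simp
    have N: "real (card N) = real q powr real l" unfolding cN using powr_realpow[OF q0] by simp
    have total: "real (a - c + l) + real A = real k * real s * real L + real k * real s * real A + real s * real A"
      using arg_cong[OF dims(5), of real] by simp
    \<comment> \<open>With \<open>a\<close> and \<open>l\<close> expressed through \<open>A\<close>
      and \<open>L\<close>, the required exponent becomes the integer
      \<open>a - c + l\<close>.\<close>
    have "real a * (1 / 2 + 1 / (2 * real k) - 1 / (2 * real k * real s)) + real l * (1 / 2)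
        = real k * real s * real A + real s * real A - real A + real k * real s * real L"
      unfolding ra \<alpha>l unfolding L using assms(1,2) by (simp add: field_simps)
    then have ex: "real a * (1 / 2 + 1 / (2 * real k) - 1 / (2 * real k * real s)) + real l * (1 / 2)
        = real (a - c + l)"
      using total by linarith
    have "1 / 2 * real (card M) powr (1 / 2 + 1 / (2 * real k) - 1 / (2 * real k * real s))
        * real (card N) powr (1 / 2) = 1 / 2 * real q powr real (a - c + l)"
      unfolding M N powr_powr ra[symmetric] ex[symmetric] powr_add by simp
    also have "\<dots> \<le> real (q ^ (a - c + l))" using powr_realpow[OF q0, of "a - c + l"] by (simp del: of_nat_add)
    also have "\<dots> \<le> real (card (edges G))" using e by (simp only: of_nat_le_iff)
    finally have "1 / 2 * real (card M) powr (1 / 2 + 1 / (2 * real k) - 1 / (2 * real k * real s))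
        * real (card N) powr (1 / 2) \<le> real (card (edges G))" .
    then show "\<exists>(G :: nat ugraph) M N.
        bipartite_with_parts G M N \<and>
        real (card M) = real q powr (\<alpha> * real l) \<and>
        card N = q ^ l \<and>
        is_free (subdivision (2 * k) (complete_bipartite s t)) G \<and>
        real (card (edges G)) \<ge>
          1 / 2 * real (card M) powr (1 / 2 + 1 / (2 * real k) - 1 / (2 * real k * real s))
                * real (card N) powr (1 / 2)"
      using G M cN by (intro exI[of _ G] exI[of _ M] exI[of _ N] conjI)
  qed
qed

end
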